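(* Suppose Assumption A1 and Assumption A2(ii) hold, and that the minimum in the definition of $\mathrm{Regret}_T$ (over $\mathcal U(\kappa,\gamma)$) is attained. Let $K$ be $(\kappa,\gamma)$-strongly stable. Then for every $T\ge 3$ and every $\delta\in(0,1]$, Algorithm DAP-OGD run with constant learning rate $\eta_t\equiv (\sqrt T(\log T)^3)^{-1}$ satisfies, with probability at least $1-\delta$, $$\mathrm{Regret}_T\le\Big(\frac{2\sqrt3\,G_c C_\delta^3}{\sqrt\gamma}+\frac{D^2}{2}\Big)\sqrt T(\log T)^3+\frac{C_\delta}{2}\sqrt T\log T+6G_cC_\delta^2(\log T)^2,$$ where $D:=\frac{4\kappa_B\kappa^3\sqrt n}{\gamma}$, $C_\delta:=\frac{65724\,\sigma_w^{[1,4]} n^2G_c^2\kappa_B^6\kappa^{18}}{\delta\gamma^8(1-\gamma)^4}$, and $\sigma_w^{[1,4]}:=\max\{\sigma_w,\sigma_w^4\}$.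
   Context: Linear system $x_{t+1}=Ax_t+Bu_t+w_t$, $t\ge 0$, with $x_0=0$, $x_t,w_t\in\mathbb R^{n_x}$, $u_t\in\mathbb R^{n_u}$, $A,B$ known; $n:=\max\{n_x,n_u\}$, $\kappa_B:=\max\{\|B\|,1\}$; $\|\cdot\|$ is the spectral/Euclidean norm, $\|\cdot\|_F$ the Frobenius norm, $\log$ natural log. $\{w_t\}$ is a stochastic noise process (not assumed i.i.d.); convention $w_s:=0$ for $s<0$. Cost functions $c_t:\mathbb R^{n_x}\times\mathbb R^{n_u}\to\mathbb R$, $t=0,\dots,T-1$, fixed in advance; $c_t$ is revealed only after $u_t$ is chosen. $J_T(\{u_t\})=\sum_{t=0}^{T-1}c_t(x_t,u_t)$. Strong stability: for $\kappa\ge1,\gamma\in(0,1)$, $K\in\mathbb R^{n_u\times n_x}$ is $(\kappa,\gamma)$-strongly stable if there are complex matrices $P,Q$ with $A-BK=QPQ^{-1}$, $\|P\|\le1-\gamma$, $\|K\|,\|Q\|,\|Q^{-1}\|\le\kappa$. $\mathcal K(\kappa,\gamma)$ is the set of such $K$; $\mathcal U(\kappa,\gamma)$ is the set of input sequences $u_t=-K'x_t$ ($t\in[0,T-1]$) for some $K'\in\mathcal K(\kappa,\gamma)$, driven by the same noise realization. $\mathrm{Regret}_T:=J_T(\{u_t\})-\min_{\{u^*_t\}\in\mathcal U(\kappa,\gamma)}J_T(\{u_t^*\})$. Assumption A1: each $c_t$ is convex and differentiable, and there is $G_c\ge1$ with $\|\nabla_xc_t(x,u)\|\le G_c\|x\|$,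 $\|\nabla_uc_t(x,u)\|\le G_c\|u\|$ for all $x,u,t$. Assumption A2: (i) $\mathbb E\|w_t\|\le\sigma_w$ for all $t$; (ii) $\mathbb E\|w_t\|^4\le\sigma_w^4$ for all $t$ (for some $\sigma_w\ge0$). Parameters: $H:=\lceil 2\gamma^{-1}\log T\rceil$; $M=\{M^{[0]},\dots,M^{[H-1]}\}$, $M^{[i]}\in\mathbb R^{n_u\times n_x}$, with $\|M\|_F:=\|[M^{[0]},\dots,M^{[H-1]}]\|_F$; $\mathcal M:=\{M:\|M^{[i]}\|\le2\kappa_B\kappa^3(1-\gamma)^i,\ i=0,\dots,H-1\}$. $A_K:=A-BK$. Surrogate cost: $\Psi^{K,h}_{t,i}(M_{t-h:t}):=A_K^i\mathbf 1_{i\le h}+\sum_{j=0}^hA_K^jBM_{t-j}^{[i-j-1]}\mathbf 1_{i-j\in[1,H]}$; $y_t(M_{t-1-H:t-1}):=\sum_{i=0}^{2H}\Psi^{K,H}_{t-1,i}(M_{t-1-H:t-1})w_{t-1-i}$; $v_t(M_{t-1-H:t}):=-Ky_t+\sum_{i=1}^HM_t^{[i-1]}w_{t-i}$; $F_t(M_{t-1-H:t}):=c_t(y_t,v_t)$ and $f_t(M):=F_t(M,\dots,M)$. Algorithm DAP-OGD (inputs $\kappa,\gamma$, learning rates $\eta_t$, a $(\kappa,\gamma)$-strongly stable $K$, $M_0\in\mathcal M$): for $t=0,\dots,T-1$: apply $u_t=-Kx_t+\sum_{i=1}^HM_t^{[i-1]}w_{t-i}$; observe $c_t$, pay $c_t(x_t,u_t)$;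 observe $x_{t+1}$ and set $w_t=x_{t+1}-Ax_t-Bu_t$; update $M_{t+1}=\Pi_{\mathcal M}(M_t-\eta_t\nabla_Mf_t(M_t))$, where $\Pi_{\mathcal M}$ is the Frobenius-norm projection onto $\mathcal M$. *)

theory Defs
  imports "HOL-Analysis.Analysis" "HOL-Probability.Probability"
begin

(* Matrices: real^'c^'r is an r x c matrix; M *v x is matrix-vector product.
   Spectral norm of a matrix M := onorm (\<lambda>x. M *v x) (operator norm w.r.t. Euclidean norms).
   The vector norm of real^'c^'r is the Frobenius norm. *)

definition spec_norm :: "'a::real_normed_algebra_1^'c^'r \<Rightarrow> real" where
  "spec_norm M = onorm (\<lambda>x::'a^'c. M *v x)"

definition mat_cpx :: "real^'c^'r \<Rightarrow> complex^'c^'r" where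
  "mat_cpx M = (\<chi> i j. complex_of_real (M$i$j))"

definition matpow :: "'a::semiring_1^'n^'n \<Rightarrow> nat \<Rightarrow> 'a^'n^'n" where
  "matpow M k = ((\<lambda>X. M ** X) ^^ k) (mat 1)"

definition strongly_stable ::
  "real \<Rightarrow> real \<Rightarrow> real^'nx::finite^'nx::finite \<Rightarrow> real^'nu::finite^'nx::finite \<Rightarrow> real^'nx::finite^'nu::finite \<Rightarrow> bool" where
  "strongly_stable \<kappa> \<gamma> A B K \<longleftrightarrow>
     (\<exists>(P::complex^'nx::finite^'nx::finite) (Q::complex^'nx::finite^'nx::finite) (Qinv::complex^'nx::finite^'nx::finite).
        Q ** Qinv = mat 1 \<and> Qinv ** Q = mat 1 \<and>
        mat_cpx (A - B ** K) = Q ** P ** Qinv \<and>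
        spec_norm P \<le> 1 - \<gamma> \<and> spec_norm K \<le> \<kappa> \<and>
        spec_norm Q \<le> \<kappa> \<and> spec_norm Qinv \<le> \<kappa>)"

definition KK :: "real \<Rightarrow> real \<Rightarrow> real^'nx::finite^'nx::finite \<Rightarrow> real^'nu::finite^'nx::finite \<Rightarrow> (real^'nx::finite^'nu::finite) set" where
  "KK \<kappa> \<gamma> A B = {K. strongly_stable \<kappa> \<gamma> A B K}"

definition wext :: "(nat \<Rightarrow> 'a::zero) \<Rightarrow> int \<Rightarrow> 'a" where
  "wext w s = (if s < 0 then 0 else w (nat s))"

(* A DAP parameter M = {M^[0],...,M^[H-1]} is represented as a function nat => matrix
   (entries with index \<ge> H are irrelevant / zero in the constraint set). *)
type_synonym ('nx,'nu) dap = "nat \<Rightarrow> real^'nx^'nu"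

(* Psi^{K,h}_{t,i}(M_{t-h:t}); Ms s is the parameter at time s *)
definition Psi ::
  "nat \<Rightarrow> real^'nx::finite^'nx::finite \<Rightarrow> real^'nu::finite^'nx::finite \<Rightarrow> real^'nx::finite^'nu::finite \<Rightarrow> nat \<Rightarrow>
   (int \<Rightarrow> ('nx::finite,'nu::finite) dap) \<Rightarrow> int \<Rightarrow> nat \<Rightarrow> real^'nx::finite^'nx::finite" where
  "Psi H A B K h Ms t i =
     (if i \<le> h then matpow (A - B ** K) i else 0) +
     (\<Sum>j\<in>{0..h}. if j < i \<and> i - j \<le> H
         then matpow (A - B ** K) j ** B ** Ms (t - int j) (i - j - 1) else 0)"

definition ysur ::
  "nat \<Rightarrow> real^'nx::finite^'nx::finite \<Rightarrow> real^'nu::finite^'nx::finite \<Rightarrow> real^'nx::finite^'nu::finite \<Rightarrow> (nat \<Rightarrow> real^'nx::finite) \<Rightarrow>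
   (int \<Rightarrow> ('nx::finite,'nu::finite) dap) \<Rightarrow> nat \<Rightarrow> real^'nx::finite" where
  "ysur H A B K w Ms t =
     (\<Sum>i\<in>{0..2*H}. Psi H A B K H Ms (int t - 1) i *v wext w (int t - 1 - int i))"

definition vsur ::
  "nat \<Rightarrow> real^'nx::finite^'nx::finite \<Rightarrow> real^'nu::finite^'nx::finite \<Rightarrow> real^'nx::finite^'nu::finite \<Rightarrow> (nat \<Rightarrow> real^'nx::finite) \<Rightarrow>
   (int \<Rightarrow> ('nx::finite,'nu::finite) dap) \<Rightarrow> nat \<Rightarrow> real^'nu::finite" where
  "vsur H A B K w Ms t =
     - (K *v ysur H A B K w Ms t) +
     (\<Sum>i\<in>{1..H}. Ms (int t) (i - 1) *v wext w (int t - int i))"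

definition Fsur ::
  "(nat \<Rightarrow> real^'nx::finite \<Rightarrow> real^'nu::finite \<Rightarrow> real) \<Rightarrow>
   nat \<Rightarrow> real^'nx::finite^'nx::finite \<Rightarrow> real^'nu::finite^'nx::finite \<Rightarrow> real^'nx::finite^'nu::finite \<Rightarrow> (nat \<Rightarrow> real^'nx::finite) \<Rightarrow>
   nat \<Rightarrow> (int \<Rightarrow> ('nx::finite,'nu::finite) dap) \<Rightarrow> real" where
  "Fsur c H A B K w t Ms = c t (ysur H A B K w Ms t) (vsur H A B K w Ms t)"

definition fsur ::
  "(nat \<Rightarrow> real^'nx::finite \<Rightarrow> real^'nu::finite \<Rightarrow> real) \<Rightarrow>
   nat \<Rightarrow> real^'nx::finite^'nx::finite \<Rightarrow> real^'nu::finite^'nx::finite \<Rightarrow> real^'nx::finite^'nu::finite \<Rightarrow> (nat \<Rightarrow> real^'nx::finite) \<Rightarrow>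
   nat \<Rightarrow> ('nx::finite,'nu::finite) dap \<Rightarrow> real" where
  "fsur c H A B K w t M = Fsur c H A B K w t (\<lambda>_. M)"

definition gradM :: "nat \<Rightarrow> (('nx::finite,'nu::finite) dap \<Rightarrow> real) \<Rightarrow> ('nx::finite,'nu::finite) dap \<Rightarrow> ('nx::finite,'nu::finite) dap" where
  "gradM H g M = (\<lambda>i. if i < H then
      (\<chi> r s. deriv (\<lambda>e. g (M(i := M i + e *\<^sub>R (\<chi> r' s'. if r' = r \<and> s' = s then 1 else 0)))) 0)
    else 0)"

definition Mset :: "nat \<Rightarrow> real \<Rightarrow> real \<Rightarrow> real \<Rightarrow> ('nx::finite,'nu::finite) dap set" where
  "Mset H \<kappa>B \<kappa> \<gamma> = {M. (\<forall>i<H. spec_norm (M i) \<le> 2 * \<kappa>B * \<kappa>^3 * (1 - \<gamma>)^i) \<and> (\<forall>i\<ge>H. M i = 0)}"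

definition frob :: "nat \<Rightarrow> ('nx::finite,'nu::finite) dap \<Rightarrow> real" where
  "frob H M = sqrt (\<Sum>i<H. (norm (M i))\<^sup>2)"

definition projM :: "nat \<Rightarrow> ('nx::finite,'nu::finite) dap set \<Rightarrow> ('nx::finite,'nu::finite) dap \<Rightarrow> ('nx::finite,'nu::finite) dap" where
  "projM H S N = (THE P. P \<in> S \<and> (\<forall>Q\<in>S. frob H (\<lambda>i. N i - P i) \<le> frob H (\<lambda>i. N i - Q i)))"

primrec dapM ::
  "(nat \<Rightarrow> real^'nx::finite \<Rightarrow> real^'nu::finite \<Rightarrow> real) \<Rightarrow> nat \<Rightarrow> real \<Rightarrow> real \<Rightarrow> (nat \<Rightarrow> real) \<Rightarrow>
   real^'nx::finite^'nx::finite \<Rightarrow> real^'nu::finite^'nx::finite \<Rightarrow> real^'nx::finite^'nu::finite \<Rightarrow> ('nx::finite,'nu::finite) dap \<Rightarrow> (nat \<Rightarrow> real^'nx::finite) \<Rightarrow>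
   nat \<Rightarrow> ('nx::finite,'nu::finite) dap" where
  "dapM c H \<kappa> \<gamma> \<eta> A B K M0 w 0 = M0"
| "dapM c H \<kappa> \<gamma> \<eta> A B K M0 w (Suc t) =
     projM H (Mset H (max (spec_norm B) 1) \<kappa> \<gamma>)
       (\<lambda>i. dapM c H \<kappa> \<gamma> \<eta> A B K M0 w t i
             - \<eta> t *\<^sub>R gradM H (fsur c H A B K w t) (dapM c H \<kappa> \<gamma> \<eta> A B K M0 w t) i)"

definition dapu ::
  "(nat \<Rightarrow> real^'nx::finite \<Rightarrow> real^'nu::finite \<Rightarrow> real) \<Rightarrow> nat \<Rightarrow> real \<Rightarrow> real \<Rightarrow> (nat \<Rightarrow> real) \<Rightarrow>
   real^'nx::finite^'nx::finite \<Rightarrow> real^'nu::finite^'nx::finite \<Rightarrow> real^'nx::finite^'nu::finite \<Rightarrow> ('nx::finite,'nu::finite) dap \<Rightarrow> (nat \<Rightarrow> real^'nx::finite) \<Rightarrow>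
   nat \<Rightarrow> real^'nx::finite \<Rightarrow> real^'nu::finite" where
  "dapu c H \<kappa> \<gamma> \<eta> A B K M0 w t x =
     - (K *v x) + (\<Sum>i\<in>{1..H}. dapM c H \<kappa> \<gamma> \<eta> A B K M0 w t (i - 1) *v wext w (int t - int i))"

primrec dapx ::
  "(nat \<Rightarrow> real^'nx::finite \<Rightarrow> real^'nu::finite \<Rightarrow> real) \<Rightarrow> nat \<Rightarrow> real \<Rightarrow> real \<Rightarrow> (nat \<Rightarrow> real) \<Rightarrow>
   real^'nx::finite^'nx::finite \<Rightarrow> real^'nu::finite^'nx::finite \<Rightarrow> real^'nx::finite^'nu::finite \<Rightarrow> ('nx::finite,'nu::finite) dap \<Rightarrow> (nat \<Rightarrow> real^'nx::finite) \<Rightarrow>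
   nat \<Rightarrow> real^'nx::finite" where
  "dapx c H \<kappa> \<gamma> \<eta> A B K M0 w 0 = 0"
| "dapx c H \<kappa> \<gamma> \<eta> A B K M0 w (Suc t) =
     A *v dapx c H \<kappa> \<gamma> \<eta> A B K M0 w t
     + B *v dapu c H \<kappa> \<gamma> \<eta> A B K M0 w t (dapx c H \<kappa> \<gamma> \<eta> A B K M0 w t) + w t"

definition dap_cost ::
  "(nat \<Rightarrow> real^'nx::finite \<Rightarrow> real^'nu::finite \<Rightarrow> real) \<Rightarrow> nat \<Rightarrow> real \<Rightarrow> real \<Rightarrow> (nat \<Rightarrow> real) \<Rightarrow>
   real^'nx::finite^'nx::finite \<Rightarrow> real^'nu::finite^'nx::finite \<Rightarrow> real^'nx::finite^'nu::finite \<Rightarrow> ('nx::finite,'nu::finite) dap \<Rightarrow> (nat \<Rightarrow> real^'nx::finite) \<Rightarrow>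
   nat \<Rightarrow> real" where
  "dap_cost c H \<kappa> \<gamma> \<eta> A B K M0 w T =
     (\<Sum>t<T. c t (dapx c H \<kappa> \<gamma> \<eta> A B K M0 w t)
                 (dapu c H \<kappa> \<gamma> \<eta> A B K M0 w t (dapx c H \<kappa> \<gamma> \<eta> A B K M0 w t)))"

primrec linx :: "real^'nx::finite^'nx::finite \<Rightarrow> real^'nu::finite^'nx::finite \<Rightarrow> real^'nx::finite^'nu::finite \<Rightarrow> (nat \<Rightarrow> real^'nx::finite) \<Rightarrow> nat \<Rightarrow> real^'nx::finite" where
  "linx A B K' w 0 = 0"
| "linx A B K' w (Suc t) = A *v linx A B K' w t + B *v (- (K' *v linx A B K' w t)) + w t"

definition lin_cost ::
  "(nat \<Rightarrow> real^'nx::finite \<Rightarrow> real^'nu::finite \<Rightarrow> real) \<Rightarrow> real^'nx::finite^'nx::finite \<Rightarrow> real^'nu::finite^'nx::finite \<Rightarrow> real^'nx::finite^'nu::finite \<Rightarrow>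
   (nat \<Rightarrow> real^'nx::finite) \<Rightarrow> nat \<Rightarrow> real" where
  "lin_cost c A B K' w T = (\<Sum>t<T. c t (linx A B K' w t) (- (K' *v linx A B K' w t)))"

definition assumption_A1 :: "(nat \<Rightarrow> real^'nx::finite \<Rightarrow> real^'nu::finite \<Rightarrow> real) \<Rightarrow> real \<Rightarrow> bool" where
  "assumption_A1 c Gc \<longleftrightarrow> Gc \<ge> 1 \<and>
     (\<forall>t. convex_on UNIV (\<lambda>(x, u). c t x u) \<and>
       (\<forall>x u. \<exists>gx gu. ((\<lambda>(x', u'). c t x' u') has_derivative (\<lambda>(dx, du). gx \<bullet> dx + gu \<bullet> du)) (at (x, u))
              \<and> norm gx \<le> Gc * norm x \<and> norm gu \<le> Gc * norm u))"

end

theory Submission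
  imports Defs
begin

text \<open>
  Fix a noise path, let \<open>\<rho> = 1 - \<gamma>\<close>, let \<open>S\<close> be the noise norms convolved with the geometric weights
  \<open>\<rho>^j\<close>, and \<open>R\<close> the convolution of \<open>S\<close> with the same weights. Strong stability bounds
  all states and inputs that occur (true and surrogate, for every policy in the constraint set)
  by a multiple \<open>V\<close> of \<open>S + R\<close>. Convexity of the costs then gives one-sided first-order bounds for
  each of the four terms of the regret: truncating the closed loop (an error of order
  \<open>\<rho>^H \<le> T^-2\<close>), replacing the past parameters by the current one, online gradient descent on \<open>f_t\<close>, and
  approximating the best linear controller \<open>K'\<close> by the disturbance-action policy
  \<open>M^[i] = (K - K') (A - B K')^i\<close>. The random part of the bound is a sum of products of two or four
  quantities with controlled fourth moments, so its mean is a combination of \<open>\<sigma>^2\<close> and \<open>\<sigma>^4\<close>, and a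
  single application of Markov's inequality yields the claim.
\<close>

section \<open>Matrix norms and strong stability\<close>

text \<open>The noise is neither bounded nor independent, so no deterministic bound on the states
  exists. Estimates therefore stay explicit functions of the noise path until the end, and the
  expectation is handled by the triangle inequality in L^4, which asks nothing of the joint law. The
  exponent is four because a squared gradient is (state * sensitivity)^2 and the drift term is state
  * noise * state * sensitivity. Cost gradients grow with the point at which they are taken. Each
  comparison takes the gradient at its first point, which is a state and input already bounded by
  \<open>V\<close>; the second point, in particular the trajectory of \<open>K'\<close>, is
  unrestricted. The resulting pathwise bound does not mention \<open>K'\<close>, so one event serves
  every comparator, including a minimiser that depends on the noise. The powers \<kappa>^18 and
  \<kappa>_B^6 are those of the squared gradient and the drift; the eighth power of 1/\<gamma> is
  their seventh times the one in H <= 3 log T / \<gamma>.\<close>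

lemma bounded_linear_matvec:
  fixes M :: "'a::{real_normed_algebra_1,euclidean_space}^'c^'r"
  shows "bounded_linear (\<lambda>x. M *v x)"
proof -
  have "linear (\<lambda>x. M *v x)"
    by (rule linearI)
       (simp_all add: vec_eq_iff matrix_vector_mult_def distrib_left sum.distrib scaleR_sum_right)
  then show ?thesis by (simp add: linear_conv_bounded_linear)
qed

lemma norm_matvec_le:
  fixes M :: "'a::{real_normed_algebra_1,euclidean_space}^'c^'r"
  shows "norm (M *v x) \<le> spec_norm M * norm x"
  unfolding spec_norm_def by (rule onorm[OF bounded_linear_matvec])

lemma spec_norm_nonneg:
  fixes M :: "'a::{real_normed_algebra_1,euclidean_space}^'c^'r"
  shows "0 \<le> spec_norm M"
  unfolding spec_norm_def by (rule onorm_pos_le[OF bounded_linear_matvec])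

lemma norm_matvec_le_of_spec_norm_le:
  fixes M :: "'a::{real_normed_algebra_1,euclidean_space}^'c^'r"
  assumes "spec_norm M \<le> a"
  shows "norm (M *v x) \<le> a * norm x"
  using norm_matvec_le[of M x] mult_right_mono[OF assms, of "norm x"] by simp

lemma spec_norm_le_iff:
  fixes M :: "real^'c^'r"
  assumes "0 \<le> a"
  shows "spec_norm M \<le> a \<longleftrightarrow> (\<forall>x. norm (M *v x) \<le> a * norm x)"
proof
  assume "\<forall>x. norm (M *v x) \<le> a * norm x"
  then show "spec_norm M \<le> a"
    unfolding spec_norm_def by (intro onorm_le) auto
qed (auto intro: norm_matvec_le_of_spec_norm_le)

lemma norm_matvec_le_frobenius:
  fixes M :: "real^'c^'r"
  shows "norm (M *v x) \<le> norm M * norm x"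
proof -
  have "norm (M *v x) = L2_set (\<lambda>i. \<bar>(M $ i) \<bullet> x\<bar>) UNIV"
    by (simp add: norm_vec_def matrix_vector_mul_component)
  also have "\<dots> \<le> L2_set (\<lambda>i. norm (M $ i) * norm x) UNIV"
    by (intro L2_set_mono) (auto simp: Cauchy_Schwarz_ineq2)
  also have "\<dots> = norm M * norm x"
    by (simp add: norm_vec_def[of M] L2_set_left_distrib)
  finally show ?thesis .
qed

text \<open>The columns are images of unit vectors, so each has norm at most \<open>a\<close>; their
  squares add up to the squared Frobenius norm.\<close>

lemma frobenius_le_spec_norm:
  fixes M :: "real^'c^'r"
  assumes "\<And>x. norm (M *v x) \<le> a * norm x"
  shows "(norm M)\<^sup>2 \<le> real CARD('c) * a\<^sup>2"
proof -
  have "(norm M)\<^sup>2 = (\<Sum>i\<in>UNIV. (norm (M $ i))\<^sup>2)"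
    by (simp add: norm_vec_def[of M] L2_set_def sum_nonneg)
  also have "\<dots> = (\<Sum>i\<in>UNIV. \<Sum>j\<in>UNIV. (M $ i $ j)\<^sup>2)"
    by (simp add: norm_vec_def L2_set_def sum_nonneg)
  also have "\<dots> = (\<Sum>j\<in>UNIV. \<Sum>i\<in>UNIV. (M $ i $ j)\<^sup>2)"
    by (rule sum.swap)
  also have "\<dots> = (\<Sum>j\<in>UNIV. (norm (M *v axis j 1))\<^sup>2)"
    by (simp add: norm_vec_def L2_set_def sum_nonneg matrix_vector_mult_basis column_def)
  also have "\<dots> \<le> (\<Sum>j\<in>(UNIV::'c set). a\<^sup>2)"
  proof (rule sum_mono)
    fix j :: 'c
    have "norm (M *v axis j 1) \<le> a" using assms[of "axis j 1"] by simp
    then show "(norm (M *v axis j 1))\<^sup>2 \<le> a\<^sup>2" by (intro power_mono) auto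
  qed
  finally show ?thesis by simp
qed

lemma matpow_0 [simp]: "matpow M 0 *v x = x"
  by (simp add: matpow_def)

lemma matpow_Suc: "matpow M (Suc k) *v x = M *v (matpow M k *v x)"
  by (simp add: matpow_def matrix_vector_mul_assoc)

lemma matpow_Suc': "matpow M (Suc k) *v x = matpow M k *v (M *v x)"
  by (induction k) (simp_all add: matpow_Suc)

text \<open>Strong stability factors a real matrix over the complex numbers; this isometric
  embedding lets the factors act on real states.\<close>

definition cpx_vec :: "real^'n \<Rightarrow> complex^'n" where
  "cpx_vec x = (\<chi> i. complex_of_real (x $ i))"

lemma norm_cpx_vec: "norm (cpx_vec x) = norm x"
  by (simp add: cpx_vec_def norm_vec_def)

lemma cpx_vec_matvec: "mat_cpx M *v cpx_vec x = cpx_vec (M *v x)"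
  by (simp add: vec_eq_iff cpx_vec_def mat_cpx_def matrix_vector_mult_def)

lemma norm_matpow_le:
  fixes P :: "'a::{real_normed_algebra_1,euclidean_space}^'n^'n"
  assumes "spec_norm P \<le> r"
  shows "norm (matpow P k *v x) \<le> r ^ k * norm x"
proof (induction k)
  case (Suc k)
  have r: "0 \<le> r" using assms spec_norm_nonneg[of P] by linarith
  have "norm (matpow P (Suc k) *v x) \<le> r * norm (matpow P k *v x)"
    unfolding matpow_Suc by (rule norm_matvec_le_of_spec_norm_le[OF assms])
  also have "\<dots> \<le> r * (r ^ k * norm x)" using Suc r by (rule mult_left_mono)
  finally show ?case by (simp add: mult.assoc)
qed simp

lemma strongly_stable_gain:
  assumes "strongly_stable \<kappa> \<gamma> A B K"
  shows "spec_norm K \<le> \<kappa>"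
  using assms unfolding strongly_stable_def by blast

text \<open>Powers telescope through the similarity, so \<open>Q\<close> and \<open>Qi\<close> cost
  one factor \<kappa> each, whatever \<open>k\<close> is.\<close>

lemma strongly_stable_matpow:
  fixes A :: "real^'nx^'nx" and B :: "real^'nu^'nx"
  assumes "strongly_stable \<kappa> \<gamma> A B K"
  shows "norm (matpow (A - B ** K) k *v x) \<le> \<kappa>\<^sup>2 * (1 - \<gamma>) ^ k * norm x"
proof -
  obtain P Q Qi :: "complex^'nx^'nx" where
    Q: "Qi ** Q = mat 1" "Q ** Qi = mat 1" "mat_cpx (A - B ** K) = Q ** P ** Qi"
      "spec_norm P \<le> 1 - \<gamma>" "spec_norm Q \<le> \<kappa>" "spec_norm Qi \<le> \<kappa>"
    using assms unfolding strongly_stable_def by blast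
  have kap: "0 \<le> \<kappa>" using Q(5) spec_norm_nonneg[of Q] by linarith
  have g: "0 \<le> 1 - \<gamma>" using Q(4) spec_norm_nonneg[of P] by linarith
  have inv: "Qi *v (Q *v z) = z" "Q *v (Qi *v z) = z" for z
    using Q(1,2) by (simp_all add: matrix_vector_mul_assoc)
  have eq: "cpx_vec (matpow (A - B ** K) k *v x) = Q *v (matpow P k *v (Qi *v cpx_vec x))" for k
  proof (induction k)
    case (Suc k)
    have "cpx_vec (matpow (A - B ** K) (Suc k) *v x)
        = mat_cpx (A - B ** K) *v cpx_vec (matpow (A - B ** K) k *v x)"
      by (simp add: matpow_Suc cpx_vec_matvec)
    also have "\<dots> = Q *v (P *v (Qi *v (Q *v (matpow P k *v (Qi *v cpx_vec x)))))"
      unfolding Q(3) Suc by (simp add: matrix_vector_mul_assoc[symmetric])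
    finally show ?case by (simp add: matpow_Suc inv)
  qed (simp add: inv)
  have "norm (matpow (A - B ** K) k *v x) = norm (Q *v (matpow P k *v (Qi *v cpx_vec x)))"
    by (metis eq norm_cpx_vec)
  also have "\<dots> \<le> \<kappa> * norm (matpow P k *v (Qi *v cpx_vec x))"
    by (rule norm_matvec_le_of_spec_norm_le[OF Q(5)])
  also have "\<dots> \<le> \<kappa> * ((1 - \<gamma>) ^ k * norm (Qi *v cpx_vec x))"
    by (rule mult_left_mono[OF norm_matpow_le[OF Q(4)] kap])
  also have "\<dots> \<le> \<kappa> * ((1 - \<gamma>) ^ k * (\<kappa> * norm x))"
    using norm_matvec_le_of_spec_norm_le[OF Q(6), of "cpx_vec x"] kap g
    by (intro mult_left_mono) (auto simp: norm_cpx_vec)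
  finally show ?thesis by (simp add: power2_eq_square mult_ac)
qed

section \<open>Fourth moments\<close>

context prob_space begin

text \<open>The nonnegative integral avoids tracking integrability. The condition on the sign of
  \<open>r\<close> is part of the predicate because \<open>ennreal\<close> sends negative reals to
  0, which would spoil sums of bounds.\<close>

definition mean_bdd :: "('a \<Rightarrow> real) \<Rightarrow> real \<Rightarrow> bool" where
  "mean_bdd Z r \<longleftrightarrow> Z \<in> borel_measurable M \<and> (\<forall>\<omega>. 0 \<le> Z \<omega>) \<and> 0 \<le> r \<and>
     (\<integral>\<^sup>+\<omega>. ennreal (Z \<omega>) \<partial>M) \<le> ennreal r"

text \<open>The L^4 norm is at most \<open>q\<close>, written without roots.\<close>

definition L4_bdd :: "('a \<Rightarrow> real) \<Rightarrow> real \<Rightarrow> bool" where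
  "L4_bdd X q \<longleftrightarrow> X \<in> borel_measurable M \<and> (\<forall>\<omega>. 0 \<le> X \<omega>) \<and> 0 \<le> q \<and>
     (\<integral>\<^sup>+\<omega>. ennreal (X \<omega> ^ 4) \<partial>M) \<le> ennreal (q ^ 4)"

lemma mean_bdd_mono: "mean_bdd Z r \<Longrightarrow> r \<le> r' \<Longrightarrow> mean_bdd Z r'"
  unfolding mean_bdd_def by (auto intro: order_trans ennreal_leI)

lemma mean_bdd_add:
  assumes "mean_bdd X q" "mean_bdd Y r"
  shows "mean_bdd (\<lambda>\<omega>. X \<omega> + Y \<omega>) (q + r)"
  using assms unfolding mean_bdd_def
  by (auto simp: nn_integral_add ennreal_plus intro!: add_mono)

lemma mean_bdd_zero: "mean_bdd (\<lambda>\<omega>. 0) 0"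
  unfolding mean_bdd_def by simp

lemma mean_bdd_sum:
  assumes "\<And>i. i \<in> I \<Longrightarrow> mean_bdd (X i) (q i)"
  shows "mean_bdd (\<lambda>\<omega>. \<Sum>i\<in>I. X i \<omega>) (\<Sum>i\<in>I. q i)"
  using assms
  by (induction I rule: infinite_finite_induct) (auto simp: mean_bdd_zero intro!: mean_bdd_add)

lemma mean_bdd_cmult:
  assumes "0 \<le> a" "mean_bdd X q"
  shows "mean_bdd (\<lambda>\<omega>. a * X \<omega>) (a * q)"
  using assms unfolding mean_bdd_def
  by (auto simp: nn_integral_cmult ennreal_mult intro!: mult_left_mono)

lemma nn_integral_mult_sq_le:
  assumes [measurable]: "X \<in> borel_measurable M" "Y \<in> borel_measurable M"
    and "\<And>\<omega>. 0 \<le> X \<omega>" "\<And>\<omega>. 0 \<le> Y \<omega>" "0 \<le> q" "0 \<le> r"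
    and "(\<integral>\<^sup>+\<omega>. ennreal (X \<omega> ^ 2) \<partial>M) \<le> ennreal (q\<^sup>2)"
    and "(\<integral>\<^sup>+\<omega>. ennreal (Y \<omega> ^ 2) \<partial>M) \<le> ennreal (r\<^sup>2)"
  shows "(\<integral>\<^sup>+\<omega>. ennreal (X \<omega> * Y \<omega>) \<partial>M) \<le> ennreal (q * r)"
proof -
  have "(\<integral>\<^sup>+\<omega>. ennreal (X \<omega>) * ennreal (Y \<omega>) \<partial>M)\<^sup>2
      \<le> (\<integral>\<^sup>+\<omega>. ennreal (X \<omega>) ^ 2 \<partial>M) * (\<integral>\<^sup>+\<omega>. ennreal (Y \<omega>) ^ 2 \<partial>M)"
    by (rule Cauchy_Schwarz_nn_integral) auto
  also have "\<dots> \<le> ennreal (q\<^sup>2) * ennreal (r\<^sup>2)"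
    using assms by (intro mult_mono) (auto simp: ennreal_power)
  also have "\<dots> = (ennreal (q * r))\<^sup>2"
    using assms by (simp add: ennreal_power ennreal_mult[symmetric] power_mult_distrib)
  finally have "(\<integral>\<^sup>+\<omega>. ennreal (X \<omega> * Y \<omega>) \<partial>M)\<^sup>2 \<le> (ennreal (q * r))\<^sup>2"
    using assms by (simp add: ennreal_mult)
  then show ?thesis
    using assms(5,6)
    by (cases "\<integral>\<^sup>+\<omega>. ennreal (X \<omega> * Y \<omega>) \<partial>M")
       (auto simp: ennreal_power power2_le_iff_abs_le top_power_ennreal top_unique)
qed

text \<open>Hoelder's inequality with four exponents 4, obtained from two rounds of
  Cauchy-Schwarz.\<close>

lemma L4_bdd_prod4:
  assumes "L4_bdd X q" "L4_bdd Y r" "L4_bdd X' q'" "L4_bdd Y' r'"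
  shows "mean_bdd (\<lambda>\<omega>. X \<omega> * Y \<omega> * (X' \<omega> * Y' \<omega>)) (q * r * (q' * r'))"
proof -
  have sq: "(\<integral>\<^sup>+\<omega>. ennreal ((X \<omega> * Y \<omega>)\<^sup>2) \<partial>M) \<le> ennreal ((q * r)\<^sup>2)"
    if "L4_bdd X q" "L4_bdd Y r" for X Y q r
    using that nn_integral_mult_sq_le[of "\<lambda>\<omega>. (X \<omega>)\<^sup>2" "\<lambda>\<omega>. (Y \<omega>)\<^sup>2" "q\<^sup>2" "r\<^sup>2"]
    unfolding L4_bdd_def by (auto simp: power_mult_distrib simp flip: power_mult)
  show ?thesis
    unfolding mean_bdd_def
    using assms sq[OF assms(1,2)] sq[OF assms(3,4)]
    by (intro conjI nn_integral_mult_sq_le) (auto simp: L4_bdd_def)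
qed

lemma L4_bdd_one: "L4_bdd (\<lambda>\<omega>. 1) 1"
  unfolding L4_bdd_def by (simp add: emeasure_space_1)

lemma L4_bdd_prod2:
  assumes "L4_bdd X q" "L4_bdd Y r"
  shows "mean_bdd (\<lambda>\<omega>. X \<omega> * Y \<omega>) (q * r)"
  using L4_bdd_prod4[OF assms L4_bdd_one L4_bdd_one] by simp

text \<open>Minkowski's inequality in L^4: each term of the binomial expansion is a product of four
  factors. No independence enters.\<close>

lemma L4_bdd_add:
  assumes "L4_bdd X q" "L4_bdd Y r"
  shows "L4_bdd (\<lambda>\<omega>. X \<omega> + Y \<omega>) (q + r)"
proof -
  have expand: "(x + y) ^ 4 = x*x*(x*x) + (4 * (x*x*(x*y)) + (6 * (x*x*(y*y)) + (4 * (x*y*(y*y)) + y*y*(y*y))))"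
    for x y :: real
    by (simp add: power4_eq_xxxx algebra_simps)
  have "mean_bdd (\<lambda>\<omega>. (X \<omega> + Y \<omega>) ^ 4) ((q + r) ^ 4)"
    \<comment> \<open>The expansion rewrites the variable and its bound alike, so the five terms
      match one by one.\<close>
    unfolding expand using assms
    by (intro mean_bdd_add mean_bdd_cmult L4_bdd_prod4) auto
  then show ?thesis
    using assms unfolding mean_bdd_def L4_bdd_def by auto
qed

lemma L4_bdd_cmult:
  assumes "0 \<le> a" "L4_bdd X q"
  shows "L4_bdd (\<lambda>\<omega>. a * X \<omega>) (a * q)"
  using assms unfolding L4_bdd_def
  by (auto simp: nn_integral_cmult ennreal_mult power_mult_distrib intro!: mult_left_mono)

lemma L4_bdd_mono: "L4_bdd X q \<Longrightarrow> q \<le> r \<Longrightarrow> L4_bdd X r"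
  unfolding L4_bdd_def by (auto intro!: ennreal_leI power_mono elim!: order_trans)

lemma L4_bdd_zero: "L4_bdd (\<lambda>\<omega>. 0) 0"
  unfolding L4_bdd_def by simp

lemma L4_bdd_sum:
  assumes "\<And>i. i \<in> I \<Longrightarrow> L4_bdd (X i) (q i)"
  shows "L4_bdd (\<lambda>\<omega>. \<Sum>i\<in>I. X i \<omega>) (\<Sum>i\<in>I. q i)"
  using assms
  by (induction I rule: infinite_finite_induct) (auto simp: L4_bdd_zero intro!: L4_bdd_add)

lemma mean_bdd_Markov:
  assumes Z: "mean_bdd Z r" and r: "r \<le> \<delta> * R" and d: "0 < \<delta>" "\<delta> \<le> 1"
  shows "prob {\<omega>\<in>space M. Z \<omega> \<le> R} \<ge> 1 - \<delta>"
proof -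
  have [measurable]: "Z \<in> borel_measurable M" and Z0: "\<And>\<omega>. 0 \<le> Z \<omega>" and r0: "0 \<le> r"
    and int: "(\<integral>\<^sup>+\<omega>. ennreal (Z \<omega>) \<partial>M) \<le> ennreal r"
    using Z unfolding mean_bdd_def by auto
  have R0: "0 \<le> R" using r r0 d by (meson order_trans zero_le_mult_iff not_le)
  have *: "emeasure M {\<omega>\<in>space M. R < Z \<omega>} \<le> ennreal \<delta>"
  \<comment> \<open>Markov's inequality divides by \<open>R\<close>. For \<open>R = 0\<close>, as
    happens with zero noise, the mean vanishes and hence so does \<open>Z\<close> almost
    surely.\<close>
  proof (cases "R = 0")
    case True
    then have "r = 0" using r r0 by simp
    then have "(\<integral>\<^sup>+\<omega>. ennreal (Z \<omega>) \<partial>M) = 0" using int by simp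
    then have "AE \<omega> in M. ennreal (Z \<omega>) = 0" by (subst (asm) nn_integral_0_iff_AE) auto
    then have "AE \<omega> in M. \<not> R < Z \<omega>" by eventually_elim (use Z0 True in \<open>auto simp: ennreal_eq_0_iff\<close>)
    then have "emeasure M {\<omega>\<in>space M. R < Z \<omega>} = 0"
      by (subst (asm) AE_iff_measurable[OF _ refl]) auto
    then show ?thesis by simp
  next
    case False
    then have R: "0 < R" using R0 by simp
    have "ennreal R * emeasure M {\<omega>\<in>space M. R < Z \<omega>} = (\<integral>\<^sup>+\<omega>. ennreal R * indicator {\<omega>\<in>space M. R < Z \<omega>} \<omega> \<partial>M)"
      by (simp add: nn_integral_cmult_indicator)
    also have "\<dots> \<le> (\<integral>\<^sup>+\<omega>. ennreal (Z \<omega>) \<partial>M)"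
      by (intro nn_integral_mono) (auto simp: indicator_def intro!: ennreal_leI)
    also have "\<dots> \<le> ennreal (R * \<delta>)"
      using int r by (auto simp: mult.commute intro: order_trans ennreal_leI)
    finally have "ennreal R * emeasure M {\<omega>\<in>space M. R < Z \<omega>} \<le> ennreal R * ennreal \<delta>"
      using R d by (simp add: ennreal_mult)
    then show ?thesis
      using R by (simp add: ennreal_mult_le_mult_iff)
  qed
  have "prob {\<omega>\<in>space M. R < Z \<omega>} \<le> \<delta>"
    using * d by (simp add: emeasure_eq_measure)
  moreover have "prob {\<omega>\<in>space M. R < Z \<omega>} = 1 - prob {\<omega>\<in>space M. Z \<omega> \<le> R}"
    by (subst prob_compl[symmetric]) (auto intro!: arg_cong[where f=prob])
  ultimately show ?thesis by simp
qed

end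

section \<open>Convex costs and the surrogate state\<close>

text \<open>A causal convolution that runs back to time 0 rather than over a window of length
  \<open>H\<close>, so that one quantity dominates all truncations.\<close>

definition geom_conv :: "real \<Rightarrow> (int \<Rightarrow> real) \<Rightarrow> int \<Rightarrow> real" where
  "geom_conv \<rho> b s = (\<Sum>j<nat s. \<rho> ^ j * b (s - 1 - int j))"

lemma geom_conv_nonneg: "0 \<le> \<rho> \<Longrightarrow> (\<And>s. 0 \<le> b s) \<Longrightarrow> 0 \<le> geom_conv \<rho> b s"
  unfolding geom_conv_def by (intro sum_nonneg) auto

lemma geom_conv_neg [simp]: "s < 0 \<Longrightarrow> geom_conv \<rho> b s = 0"
  by (simp add: geom_conv_def)

text \<open>Lags from \<open>nat s\<close> on reach negative times, where \<open>b\<close> vanishes,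
  so a window of any length \<open>m\<close> is covered.\<close>

lemma sum_le_geom_conv:
  assumes "0 \<le> \<rho>" "\<And>s. 0 \<le> b s" "\<And>s. s < 0 \<Longrightarrow> b s = 0"
  shows "(\<Sum>j<m. \<rho> ^ j * b (s - 1 - int j)) \<le> geom_conv \<rho> b s"
proof -
  have "(\<Sum>j<m. \<rho> ^ j * b (s - 1 - int j)) = (\<Sum>j<min m (nat s). \<rho> ^ j * b (s - 1 - int j))"
    by (rule sum.mono_neutral_right) (auto simp: assms(3))
  also have "\<dots> \<le> geom_conv \<rho> b s"
    unfolding geom_conv_def by (rule sum_mono2) (auto simp: assms)
  finally show ?thesis .
qed

lemma wext_neg [simp]: "s < 0 \<Longrightarrow> wext w s = 0"
  by (simp add: wext_def)

lemma wext_of_nat [simp]: "wext w (int t) = w t"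
  by (simp add: wext_def)

text \<open>Variation of constants. The recursion is required at all integer times, so
  \<open>m\<close> may reach past time 0; trajectories extended by zero satisfy it there
  too.\<close>

lemma unroll:
  fixes M :: "real^'n^'n"
  assumes "\<And>s. X s = M *v X (s - 1) + e (s - 1)"
  shows "X s = matpow M m *v X (s - int m) + (\<Sum>j<m. matpow M j *v e (s - 1 - int j))"
proof (induction m)
  case (Suc m)
  have "X (s - int m) = M *v X (s - int (Suc m)) + e (s - 1 - int m)"
    using assms[of "s - int m"] by (simp add: algebra_simps)
  then show ?case
    using Suc by (simp add: matpow_Suc' matrix_vector_right_distrib)
qed simp

text \<open>Restriction to the line through \<open>p\<close> and \<open>q\<close> reduces this to
  the scalar case. The derivative sits at \<open>p\<close>, the point whose size will be under
  control.\<close>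

lemma convex_on_tangent_ineq:
  fixes f :: "'a::real_normed_vector \<Rightarrow> real"
  assumes "convex_on UNIV f" "(f has_derivative f') (at p)"
  shows "f p - f q \<le> f' (p - q)"
proof -
  define g where "g s = f (p + s *\<^sub>R (q - p))" for s :: real
  interpret f': bounded_linear f' using assms(2) by (rule has_derivative_bounded_linear)
  have "convex_on UNIV g"
  proof (rule convex_onI)
    fix t x y :: real
    assume t: "0 < t" "t < 1"
    have "g ((1 - t) *\<^sub>R x + t *\<^sub>R y) = f ((1 - t) *\<^sub>R (p + x *\<^sub>R (q - p)) + t *\<^sub>R (p + y *\<^sub>R (q - p)))"
      by (simp add: g_def algebra_simps)
    also have "\<dots> \<le> (1 - t) * g x + t * g y"
      unfolding g_def using t by (intro convex_onD[OF assms(1)]) auto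
    finally show "g ((1 - t) *\<^sub>R x + t *\<^sub>R y) \<le> (1 - t) * g x + t * g y" .
  qed simp
  moreover have "(g has_field_derivative f' (q - p)) (at 0 within UNIV)"
  proof -
    have "(g has_derivative (\<lambda>s. f' (s *\<^sub>R (q - p)))) (at 0)"
      unfolding g_def
      by (rule has_derivative_compose[of "\<lambda>s. p + s *\<^sub>R (q - p)" _ 0 UNIV f f'])
         (auto intro!: derivative_eq_intros assms(2))
    then show ?thesis
      by (simp add: has_field_derivative_def f'.scaleR mult.commute[of _ "f' (q - p)"])
  qed
  ultimately have "g 1 - g 0 \<ge> f' (q - p) * (1 - 0)"
    by (intro convex_on_imp_above_tangent[of UNIV]) auto
  moreover have "f' (q - p) = - f' (p - q)"
    by (metis f'.neg minus_diff_eq)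
  ultimately show ?thesis by (simp add: g_def)
qed

lemma cost_tangent:
  assumes "assumption_A1 c G"
  obtains gx gu where
    "((\<lambda>(x', u'). c t x' u') has_derivative (\<lambda>(dx, du). gx \<bullet> dx + gu \<bullet> du)) (at (x, u))"
    "norm gx \<le> G * norm x" "norm gu \<le> G * norm u"
    "\<And>x' u'. c t x u - c t x' u' \<le> gx \<bullet> (x - x') + gu \<bullet> (u - u')"
proof -
  obtain gx gu where g:
    "((\<lambda>(x', u'). c t x' u') has_derivative (\<lambda>(dx, du). gx \<bullet> dx + gu \<bullet> du)) (at (x, u))"
    "norm gx \<le> G * norm x" "norm gu \<le> G * norm u"
    using assms unfolding assumption_A1_def by blast
  have "convex_on UNIV (\<lambda>(x, u). c t x u)"
    using assms unfolding assumption_A1_def by blast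
  from convex_on_tangent_ineq[OF this g(1)] have
    "c t x u - c t x' u' \<le> gx \<bullet> (x - x') + gu \<bullet> (u - u')" for x' u'
    by (metis (mono_tags, lifting) case_prod_conv diff_Pair)
  with g that show thesis by blast
qed

text \<open>Only the first point needs a bound, as the gradient is taken there. For the second point
  only its distance to the first matters.\<close>

lemma cost_diff_le:
  assumes "assumption_A1 c G"
    and "norm x \<le> V" "norm u \<le> V" "norm (x - x') \<le> a" "norm (u - u') \<le> b"
  shows "c t x u - c t x' u' \<le> G * V * (a + b)"
proof -
  have G: "0 \<le> G" using assms(1) unfolding assumption_A1_def by simp
  have V: "0 \<le> V" using assms(2) norm_ge_zero[of x] by linarith
  obtain gx gu where g: "norm gx \<le> G * norm x" "norm gu \<le> G * norm u"
    "c t x u - c t x' u' \<le> gx \<bullet> (x - x') + gu \<bullet> (u - u')"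
    using cost_tangent[OF assms(1), of t x u] by metis
  have "gx \<bullet> (x - x') \<le> norm gx * norm (x - x')" by (rule norm_cauchy_schwarz)
  also have "\<dots> \<le> (G * V) * a"
    using g(1) assms(2,4) G V by (intro mult_mono) (auto intro: order_trans mult_left_mono)
  moreover have "gu \<bullet> (u - u') \<le> norm gu * norm (u - u')" by (rule norm_cauchy_schwarz)
  moreover have "norm gu * norm (u - u') \<le> (G * V) * b"
    using g(2) assms(3,5) G V by (intro mult_mono) (auto intro: order_trans mult_left_mono)
  ultimately show ?thesis using g(3) by (simp add: distrib_left)
qed

definition dist_input :: "nat \<Rightarrow> (nat \<Rightarrow> real^'nx) \<Rightarrow> ('nx,'nu) dap \<Rightarrow> int \<Rightarrow> real^'nu" where
  "dist_input H w M s = (\<Sum>k<H. M k *v wext w (s - 1 - int k))"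

text \<open>Time 0 is included because the input at time \<open>s\<close> sees the noise only up to
  \<open>s - 1\<close>.\<close>

lemma dist_input_neg: "s \<le> 0 \<Longrightarrow> dist_input H w M s = 0"
  by (simp add: dist_input_def)

lemma sum_1_shift: "(\<Sum>i\<in>{1..H}. f i) = (\<Sum>k<H. f (Suc k))"
  by (simp add: sum.atLeast1_atMost_eq)

lemma vsur_eq: "vsur H A B K w Ms t = - (K *v ysur H A B K w Ms t) + dist_input H w (Ms (int t)) (int t)"
  unfolding vsur_def dist_input_def sum_1_shift by (simp add: algebra_simps)

lemma matvec_sum: "(M::real^'c^'r) *v (\<Sum>i\<in>I. f i) = (\<Sum>i\<in>I. M *v f i)"
  by (rule linear_sum) (rule matrix_vector_mul_linear)

lemma sum_matvec: "(\<Sum>i\<in>I. (f i :: real^'c^'r)) *v x = (\<Sum>i\<in>I. f i *v x)"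
  by (induction I rule: infinite_finite_induct) (simp_all add: matrix_vector_mult_add_rdistrib)

text \<open>Exchanging the sum over noise lags with the one over powers of A - BK exhibits the
  surrogate as the \<open>K\<close> loop run for H + 1 steps from the zero state. This replaces
  \<open>Psi\<close> in everything that follows.\<close>

lemma ysur_eq:
  "ysur H A B K w Ms t = (\<Sum>j\<le>H. matpow (A - B ** K) j *v
     (wext w (int t - 1 - int j) + B *v dist_input H w (Ms (int t - 1 - int j)) (int t - 1 - int j)))"
  (is "_ = (\<Sum>j\<le>H. ?P j *v (?w j + B *v ?d j))")
proof -
  have split: "Psi H A B K H Ms (int t - 1) i *v ?w i
     = (if i \<le> H then ?P i *v ?w i else 0)
       + (\<Sum>j\<le>H. if j < i \<and> i - j \<le> H
          then ?P j *v (B *v (Ms (int t - 1 - int j) (i - j - 1) *v ?w i)) else 0)" for i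
    unfolding Psi_def atMost_atLeast0[symmetric]
    by (auto simp: matrix_vector_mult_add_rdistrib sum_matvec matrix_vector_mul_assoc matrix_mul_assoc intro!: sum.cong)
  have "(\<Sum>i\<le>2*H. if i \<le> H then ?P i *v ?w i else 0) = (\<Sum>j\<le>H. ?P j *v ?w j)"
    by (rule sum.mono_neutral_cong_right) auto
  moreover have "(\<Sum>i\<le>2*H. if j < i \<and> i - j \<le> H
          then ?P j *v (B *v (Ms (int t - 1 - int j) (i - j - 1) *v ?w i)) else 0) = ?P j *v (B *v ?d j)"
    if "j \<le> H" for j
  proof -
    have "(\<Sum>i\<le>2*H. if j < i \<and> i - j \<le> H
          then ?P j *v (B *v (Ms (int t - 1 - int j) (i - j - 1) *v ?w i)) else 0)
        = (\<Sum>i\<in>{j<..j+H}. ?P j *v (B *v (Ms (int t - 1 - int j) (i - j - 1) *v ?w i)))"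
      using that by (intro sum.mono_neutral_cong_right) auto
    \<comment> \<open>The lag splits as \<open>i = j + 1 + k\<close>: \<open>j\<close> loop steps,
      the delay of the policy, and its own lag \<open>k\<close>. Since \<open>j \<le> H\<close>, it
      never exceeds 2H.\<close>
    also have "\<dots> = (\<Sum>k<H. ?P j *v (B *v (Ms (int t - 1 - int j) k *v wext w (int t - 1 - int j - 1 - int k))))"
      by (rule sum.reindex_bij_witness[of _ "\<lambda>k. Suc (j + k)" "\<lambda>i. i - j - 1"])
         (auto simp: of_nat_diff algebra_simps)
    finally show ?thesis by (simp add: dist_input_def matvec_sum)
  qed
  ultimately show ?thesis
    unfolding ysur_def split atMost_atLeast0[symmetric]
    by (simp add: sum.distrib sum.swap[of _ "{..H}" "{..2*H}"] matrix_vector_right_distrib)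
qed

section \<open>Projection onto the constraint set\<close>

definition spec_ball :: "real \<Rightarrow> (real^'c^'r) set" where
  "spec_ball a = {X. spec_norm X \<le> a}"

text \<open>Each set in the intersection is the preimage of a ball under a linear map, which yields
  closedness and convexity.\<close>

lemma spec_ball_altdef: "0 \<le> a \<Longrightarrow> spec_ball a = (\<Inter>x. {X. norm (X *v x) \<le> a * norm x})"
  by (auto simp: spec_ball_def spec_norm_le_iff)

lemma linear_matvec_left: "linear (\<lambda>X::real^'c^'r. X *v x)"
  by (rule linearI) (simp_all add: matrix_vector_mult_add_rdistrib scaleR_matrix_vector_assoc)

lemma closed_spec_ball: "0 \<le> a \<Longrightarrow> closed (spec_ball a :: (real^'c^'r) set)"
  unfolding spec_ball_altdef
  by (intro closed_INT ballI closed_Collect_le continuous_intros linear_continuous_on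
        linear_matvec_left[unfolded linear_conv_bounded_linear])

lemma convex_spec_ball: "0 \<le> a \<Longrightarrow> convex (spec_ball a :: (real^'c^'r) set)"
proof -
  assume "0 \<le> a"
  moreover have "convex {X::real^'c^'r. norm (X *v x) \<le> a * norm x}" for x
  proof -
    have "{X::real^'c^'r. norm (X *v x) \<le> a * norm x} = (\<lambda>X. X *v x) -` cball 0 (a * norm x)"
      by auto
    then show ?thesis by (simp add: convex_linear_vimage linear_matvec_left)
  qed
  ultimately show ?thesis by (auto simp: spec_ball_altdef intro: convex_INT)
qed

lemma zero_in_spec_ball: "0 \<le> a \<Longrightarrow> 0 \<in> spec_ball a"
  by (simp add: spec_ball_altdef)

text \<open>The set is a product of balls and the squared Frobenius distance is a sum over blocks,
  so the minimisation decouples. \<open>projM\<close> is a definite description, hence uniqueness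
  must be shown as well; for blocks from \<open>H\<close> on, which \<open>frob\<close> does not
  see, it comes from their being 0 in \<open>S\<close>.\<close>

lemma projM_eq:
  fixes N :: "('nx::finite,'nu::finite) dap"
  assumes r: "\<And>i. 0 \<le> r i" and S: "S = {M. (\<forall>i<H. M i \<in> spec_ball (r i)) \<and> (\<forall>i\<ge>H. M i = 0)}"
  shows "projM H S N = (\<lambda>i. if i < H then closest_point (spec_ball (r i)) (N i) else 0)"
proof -
  define P where "P = (\<lambda>i. if i < H then closest_point (spec_ball (r i)) (N i) else 0)"
  have ball: "closed (spec_ball (r i) :: (real^'nx^'nu) set)" "convex (spec_ball (r i) :: (real^'nx^'nu) set)"
     "(spec_ball (r i) :: (real^'nx^'nu) set) \<noteq> {}" for i
    using closed_spec_ball convex_spec_ball zero_in_spec_ball r by blast+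
  have PS: "P \<in> S" unfolding S P_def using closest_point_in_set[OF ball(1,3)] by auto
  have le: "norm (N i - P i) \<le> norm (N i - Q i)" if "Q \<in> S" "i < H" for Q i
    using that closest_point_le[OF ball(1), of "Q i" i "N i"] by (auto simp: S P_def dist_norm)
  have opt: "frob H (\<lambda>i. N i - P i) \<le> frob H (\<lambda>i. N i - Q i)" if "Q \<in> S" for Q
    unfolding frob_def using le[OF that] by (intro real_sqrt_le_mono sum_mono power_mono) auto
  have "P' = P" if P': "P' \<in> S" "\<forall>Q\<in>S. frob H (\<lambda>i. N i - P' i) \<le> frob H (\<lambda>i. N i - Q i)" for P'
  proof
    fix i
    show "P' i = P i"
    proof (cases "i < H")
      case True
      have "frob H (\<lambda>i. N i - P' i) \<le> frob H (\<lambda>i. N i - P i)" using P' PS by blast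
      then have "(\<Sum>i<H. (norm (N i - P' i))\<^sup>2) \<le> (\<Sum>i<H. (norm (N i - P i))\<^sup>2)"
        by (simp add: frob_def)
      moreover have le2: "(norm (N j - P j))\<^sup>2 \<le> (norm (N j - P' j))\<^sup>2" if "j < H" for j
        using le[OF P'(1) that] by (intro power_mono) auto
      \<comment> \<open>Termwise inequalities whose sums compare the other way must all be
        equalities.\<close>
      ultimately have "(norm (N i - P i))\<^sup>2 = (norm (N i - P' i))\<^sup>2"
        using True by (intro sum_mono_inv[of "\<lambda>i. (norm (N i - P i))\<^sup>2" "{..<H}"]) (auto intro!: antisym sum_mono)
      then have eq: "norm (N i - P i) = norm (N i - P' i)" by simp
      have "P' i = closest_point (spec_ball (r i)) (N i)"
      proof (rule closest_point_unique[OF ball(2,1)])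
        show "P' i \<in> spec_ball (r i)" using P'(1) True by (simp add: S)
        show "\<forall>z\<in>spec_ball (r i). dist (N i) (P' i) \<le> dist (N i) z"
          using closest_point_le[OF ball(1), of _ i "N i"] eq True by (auto simp: P_def dist_norm)
      qed
      then show ?thesis using True by (simp add: P_def)
    next
      case False
      then show ?thesis using P'(1) PS by (simp add: S)
    qed
  qed
  then show ?thesis
    unfolding projM_def P_def[symmetric] using PS opt by (intro the_equality) blast+
qed

section \<open>Pathwise regret\<close>

definition noise :: "(nat \<Rightarrow> real^'nx) \<Rightarrow> int \<Rightarrow> real" where
  "noise w s = norm (wext w s)"

lemma noise_nonneg [simp]: "0 \<le> noise w s"
  by (simp add: noise_def)

lemma noise_neg: "s < 0 \<Longrightarrow> noise w s = 0"
  by (simp add: noise_def)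

definition filt :: "real \<Rightarrow> (nat \<Rightarrow> real^'nx) \<Rightarrow> int \<Rightarrow> real" where
  "filt \<rho> w = geom_conv \<rho> (noise w)"

definition filt2 :: "real \<Rightarrow> (nat \<Rightarrow> real^'nx) \<Rightarrow> int \<Rightarrow> real" where
  "filt2 \<rho> w = geom_conv \<rho> (filt \<rho> w)"

text \<open>Half of the constant 4 pays for \<open>K\<close> acting on a state (bound
  \<open>Y\<close> below), half for the disturbance part of the input.\<close>

definition state_bd :: "real \<Rightarrow> real \<Rightarrow> real \<Rightarrow> (nat \<Rightarrow> real^'nx) \<Rightarrow> int \<Rightarrow> real" where
  "state_bd \<kappa> b \<rho> w s = 4 * \<kappa>^6 * b\<^sup>2 * (filt \<rho> w s + filt2 \<rho> w s)"

text \<open>\<open>G\<close> times the state bound controls the cost gradient; the last factor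
  controls how strongly state and input react to block \<open>i\<close>, which multiplies noise of
  lag i + 1.\<close>

definition grad_bd :: "real \<Rightarrow> real \<Rightarrow> real \<Rightarrow> real \<Rightarrow> (nat \<Rightarrow> real^'nx) \<Rightarrow> nat \<Rightarrow> nat \<Rightarrow> real" where
  "grad_bd G \<kappa> b \<rho> w t i =
     G * state_bd \<kappa> b \<rho> w (int t) *
       (2 * \<kappa>^3 * b * (filt \<rho> w (int t - 1 - int i) + noise w (int t - 1 - int i)))"

text \<open>The sum over \<open>s\<close> bounds the drift of block \<open>k\<close> from time t - 1
  - j to time t; \<open>nat\<close> maps negative times to the initial parameter.\<close>

definition memory_bd ::
  "real \<Rightarrow> real \<Rightarrow> real \<Rightarrow> real \<Rightarrow> real \<Rightarrow> nat \<Rightarrow> (nat \<Rightarrow> real^'nx) \<Rightarrow> nat \<Rightarrow> real" where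
  "memory_bd G \<kappa> b \<rho> \<eta> H w t =
     G * state_bd \<kappa> b \<rho> w (int t) * (2 * \<kappa> *
       (\<Sum>j\<le>H. \<kappa>\<^sup>2 * \<rho> ^ j * b * (\<Sum>k<H. (\<Sum>s\<in>{nat (int t - 1 - int j)..<t}. \<eta> * grad_bd G \<kappa> b \<rho> w s k)
           * noise w (int t - 1 - int j - 1 - int k))))"

text \<open>The first summand is the price of cutting the algorithm's own loop, the second that of
  imitating \<open>K'\<close> by a policy of length \<open>H\<close>.\<close>

definition trunc_bd ::
  "real \<Rightarrow> real \<Rightarrow> real \<Rightarrow> real \<Rightarrow> nat \<Rightarrow> (nat \<Rightarrow> real^'nx) \<Rightarrow> nat \<Rightarrow> real" where
  "trunc_bd G \<kappa> b \<rho> H w t =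
     \<rho> ^ H * (G * state_bd \<kappa> b \<rho> w (int t) * (2 * \<kappa>^3 * state_bd \<kappa> b \<rho> w (int t - 1 - int H)
       + 4 * \<kappa>^8 * b * (filt \<rho> w (int t - 1 - int H) + filt2 \<rho> w (int t - int H) + filt \<rho> w (int t - int H))))"

lemma sum_geometric_le:
  fixes \<gamma> :: real
  assumes "0 < \<gamma>" "\<gamma> < 1"
  shows "(\<Sum>j<m. (1 - \<gamma>) ^ j) \<le> 1 / \<gamma>"
proof -
  have "(\<Sum>j<m. (1 - \<gamma>) ^ j) = (1 - (1 - \<gamma>) ^ m) / \<gamma>"
    using assms by (simp add: geometric_sum field_simps)
  also have "\<dots> \<le> 1 / \<gamma>"
    using assms by (intro divide_right_mono) auto
  finally show ?thesis .
qed

lemma sum_arith_geometric_le: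
  fixes \<gamma> :: real
  assumes "0 < \<gamma>" "\<gamma> < 1"
  shows "(\<Sum>j<m. (real j + 1) * (1 - \<gamma>) ^ j) \<le> 1 / \<gamma>\<^sup>2"
proof -
  \<comment> \<open>Stating the exact remainder turns the bound into an identity that induction can
    prove.\<close>
  have "\<gamma>\<^sup>2 * (\<Sum>j<m. (real j + 1) * (1 - \<gamma>) ^ j) + (1 - \<gamma>) ^ m * (1 + real m * \<gamma>) = 1"
    by (induction m) (simp_all add: algebra_simps power2_eq_square)
  moreover have "0 \<le> (1 - \<gamma>) ^ m * (1 + real m * \<gamma>)"
    using assms by simp
  ultimately have "\<gamma>\<^sup>2 * (\<Sum>j<m. (real j + 1) * (1 - \<gamma>) ^ j) \<le> 1" by linarith
  then show ?thesis
    using assms by (subst pos_le_divide_eq) (auto simp: mult.commute)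
qed

locale dap_system =
  fixes A :: "real^'nx^'nx" and B :: "real^'nu^'nx" and K :: "real^'nx^'nu"
    and c :: "nat \<Rightarrow> real^'nx \<Rightarrow> real^'nu \<Rightarrow> real"
    and G \<kappa> \<gamma> \<eta> :: real and H :: nat and M0 :: "('nx,'nu) dap" and w :: "nat \<Rightarrow> real^'nx"
  assumes A1: "assumption_A1 c G"
    and kappa: "1 \<le> \<kappa>" and gamma: "0 < \<gamma>" "\<gamma> < 1"
    and K_stable: "strongly_stable \<kappa> \<gamma> A B K"
    and eta: "0 < \<eta>"
    and M0: "M0 \<in> Mset H (max (spec_norm B) 1) \<kappa> \<gamma>"
begin

abbreviation "b \<equiv> max (spec_norm B) 1"
abbreviation "\<rho> \<equiv> 1 - \<gamma>"
abbreviation "S \<equiv> filt \<rho> w"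
abbreviation "R \<equiv> filt2 \<rho> w"
abbreviation "V \<equiv> state_bd \<kappa> b \<rho> w"
abbreviation "gb \<equiv> grad_bd G \<kappa> b \<rho> w"
abbreviation "Apow \<equiv> matpow (A - B ** K)"
abbreviation "Mt \<equiv> dapM c H \<kappa> \<gamma> (\<lambda>_. \<eta>) A B K M0 w"
text \<open>At negative times the parameter is irrelevant: it only multiplies noise that vanishes.\<close>
abbreviation "Ms \<equiv> (\<lambda>s::int. Mt (nat s))"
abbreviation "xt \<equiv> dapx c H \<kappa> \<gamma> (\<lambda>_. \<eta>) A B K M0 w"
abbreviation "ut t \<equiv> dapu c H \<kappa> \<gamma> (\<lambda>_. \<eta>) A B K M0 w t (xt t)"
abbreviation "f \<equiv> fsur c H A B K w"
abbreviation "dis \<equiv> dist_input H w"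

section \<open>Uniform bounds for states and inputs, and truncation of the closed loop\<close>

lemma rho: "0 < \<rho>" "\<rho> < 1" "0 \<le> \<rho>" using gamma by auto
lemma b1: "1 \<le> b" by simp
lemma G1: "1 \<le> G" using A1 by (simp add: assumption_A1_def)

lemma S_nonneg [simp]: "0 \<le> S s" unfolding filt_def using rho by (intro geom_conv_nonneg) auto
lemma R_nonneg [simp]: "0 \<le> R s" unfolding filt2_def using rho by (intro geom_conv_nonneg) auto
lemma S_neg: "s < 0 \<Longrightarrow> S s = 0" by (simp add: filt_def)

lemma sum_noise_le: "(\<Sum>j<m. \<rho> ^ j * noise w (s - 1 - int j)) \<le> S s"
  unfolding filt_def using rho by (intro sum_le_geom_conv) (auto simp: noise_neg)

lemma sum_S_le: "(\<Sum>j<m. \<rho> ^ j * S (s - 1 - int j)) \<le> R s"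
  unfolding filt2_def using rho by (intro sum_le_geom_conv) (auto simp: S_neg)

lemma V_nonneg [simp]: "0 \<le> V s" unfolding state_bd_def using kappa by simp

lemma norm_B: "norm (B *v x) \<le> b * norm x"
  by (rule norm_matvec_le_of_spec_norm_le) simp
lemma norm_K: "norm (K *v x) \<le> \<kappa> * norm x"
  by (rule norm_matvec_le_of_spec_norm_le[OF strongly_stable_gain[OF K_stable]])
lemma norm_Apow: "norm (Apow j *v x) \<le> \<kappa>\<^sup>2 * \<rho> ^ j * norm x"
  by (rule strongly_stable_matpow[OF K_stable])

lemma norm_Apow_le: "norm x \<le> a \<Longrightarrow> norm (Apow j *v x) \<le> \<kappa>\<^sup>2 * \<rho> ^ j * a"
  by (rule order_trans[OF norm_Apow mult_left_mono]) (use rho in auto)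

lemma norm_B_le: "norm x \<le> a \<Longrightarrow> norm (B *v x) \<le> b * a"
  by (rule order_trans[OF norm_B mult_left_mono]) auto

lemma norm_K_le: "norm x \<le> a \<Longrightarrow> norm (K *v x) \<le> \<kappa> * a"
  by (rule order_trans[OF norm_K mult_left_mono]) (use kappa in auto)

lemma Mset_eq: "Mset H b \<kappa> \<gamma> = {M. (\<forall>i<H. M i \<in> spec_ball (2 * b * \<kappa>^3 * \<rho> ^ i)) \<and> (\<forall>i\<ge>H. M i = 0)}"
  by (simp add: Mset_def spec_ball_def)

lemma radius_nonneg: "0 \<le> 2 * b * \<kappa>^3 * \<rho> ^ i"
  using kappa rho by simp

lemma Mt_Suc: "Mt (Suc t) i = (if i < H then closest_point (spec_ball (2 * b * \<kappa>^3 * \<rho> ^ i))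
     (Mt t i - \<eta> *\<^sub>R gradM H (f t) (Mt t) i) else 0)"
  by (simp add: projM_eq[OF radius_nonneg Mset_eq])

lemma spec_ball_facts:
  shows "closed (spec_ball (2 * b * \<kappa>^3 * \<rho> ^ i) :: (real^'nx^'nu) set)"
    "convex (spec_ball (2 * b * \<kappa>^3 * \<rho> ^ i) :: (real^'nx^'nu) set)"
    "(spec_ball (2 * b * \<kappa>^3 * \<rho> ^ i) :: (real^'nx^'nu) set) \<noteq> {}"
  using closed_spec_ball convex_spec_ball zero_in_spec_ball radius_nonneg by blast+

lemma Mt_in: "Mt t \<in> Mset H b \<kappa> \<gamma>"
proof (cases t)
  case 0
  then show ?thesis using M0 by simp
next
  case (Suc t')
  show ?thesis
    unfolding Suc Mset_eq mem_Collect_eq Mt_Suc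
    using closest_point_in_set[OF spec_ball_facts(1,3)] by auto
qed

lemma Mset_bound:
  assumes "M \<in> Mset H b \<kappa> \<gamma>" "k < H"
  shows "norm (M k *v x) \<le> 2 * b * \<kappa>^3 * \<rho> ^ k * norm x"
  using assms by (intro norm_matvec_le_of_spec_norm_le) (auto simp: Mset_def)

lemma norm_dis_le:
  assumes M: "M \<in> Mset H b \<kappa> \<gamma>"
  shows "norm (dis M s) \<le> 2 * b * \<kappa>^3 * S s"
proof -
  have "norm (dis M s) \<le> (\<Sum>k<H. 2 * b * \<kappa>^3 * \<rho> ^ k * noise w (s - 1 - int k))"
    unfolding dist_input_def noise_def
    by (rule order_trans[OF norm_sum sum_mono]) (use Mset_bound[OF M] in auto)
  also have "\<dots> = 2 * b * \<kappa>^3 * (\<Sum>k<H. \<rho> ^ k * noise w (s - 1 - int k))"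
    by (simp add: sum_distrib_left mult.assoc)
  also have "\<dots> \<le> 2 * b * \<kappa>^3 * S s"
    using kappa by (intro mult_left_mono sum_noise_le) auto
  finally show ?thesis .
qed

text \<open>A state bound kept apart from \<open>V\<close>, because bounding the input costs a
  further factor \<kappa> from \<open>K\<close>.\<close>

definition Y :: "int \<Rightarrow> real" where "Y s = 2 * \<kappa>^5 * b\<^sup>2 * (S s + R s)"

text \<open>Noise enters convolved once (\<open>S\<close>), the disturbance input, already of size
  \<open>S\<close>, convolved again (\<open>R\<close>). Arbitrary \<open>m\<close> covers both the
  surrogate (\<open>Suc H\<close> steps) and the true state (all steps).\<close>

lemma norm_state_le:
  assumes D: "\<And>s. norm (D s) \<le> 2 * b * \<kappa>^3 * S s"
  shows "norm (\<Sum>j<m. Apow j *v (wext w (s - 1 - int j) + B *v D (s - 1 - int j))) \<le> Y s"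
proof -
  have "norm (\<Sum>j<m. Apow j *v (wext w (s - 1 - int j) + B *v D (s - 1 - int j)))
      \<le> (\<Sum>j<m. \<kappa>\<^sup>2 * \<rho> ^ j * (noise w (s - 1 - int j) + b * (2 * b * \<kappa>^3 * S (s - 1 - int j))))"
    unfolding noise_def
    by (intro order_trans[OF norm_sum sum_mono] norm_Apow_le order_trans[OF norm_triangle_ineq]
        add_mono order_refl norm_B_le D)
  also have "\<dots> = \<kappa>\<^sup>2 * ((\<Sum>j<m. \<rho> ^ j * noise w (s - 1 - int j))
       + 2 * b\<^sup>2 * \<kappa>^3 * (\<Sum>j<m. \<rho> ^ j * S (s - 1 - int j)))"
    by (simp add: sum_distrib_left sum.distrib[symmetric] algebra_simps power2_eq_square)
  also have "\<dots> \<le> \<kappa>\<^sup>2 * (S s + 2 * b\<^sup>2 * \<kappa>^3 * R s)"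
    using kappa by (intro mult_left_mono add_mono sum_noise_le sum_S_le) auto
  also have "\<dots> \<le> \<kappa>\<^sup>2 * (2 * b\<^sup>2 * \<kappa>^3 * S s + 2 * b\<^sup>2 * \<kappa>^3 * R s)"
  proof -
    have "1 \<le> b\<^sup>2 * \<kappa>^3" using mult_mono[of 1 "b\<^sup>2" 1 "\<kappa>^3"] kappa one_le_power[OF b1, of 2] one_le_power[OF kappa, of 3] by simp
    then have "1 * S s \<le> 2 * b\<^sup>2 * \<kappa>^3 * S s" by (intro mult_right_mono) auto
    then show ?thesis using kappa by (intro mult_left_mono add_mono) auto
  qed
  also have "\<dots> = Y s" unfolding Y_def by algebra
  finally show ?thesis .
qed

lemma Y_le_V: "Y s \<le> V s"
proof -
  have "\<kappa>^5 \<le> \<kappa>^6" "0 \<le> \<kappa>^6" using kappa by (auto intro: power_increasing)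
  then have "2 * \<kappa>^5 \<le> 4 * \<kappa>^6" by linarith
  then have "2 * \<kappa>^5 * b\<^sup>2 \<le> 4 * \<kappa>^6 * b\<^sup>2" by (intro mult_right_mono) auto
  then show ?thesis unfolding Y_def state_bd_def by (rule mult_right_mono) simp
qed

lemma norm_input_le:
  assumes "norm y \<le> Y s" "norm d \<le> 2 * b * \<kappa>^3 * S s"
  shows "norm (- (K *v y) + d) \<le> V s"
proof -
  have "norm (- (K *v y) + d) \<le> \<kappa> * Y s + 2 * b * \<kappa>^3 * S s"
    using norm_triangle_ineq[of "- (K *v y)" d] norm_K_le[OF assms(1)] assms(2) by simp
  also have "2 * b * \<kappa>^3 * S s \<le> 2 * b\<^sup>2 * \<kappa>^6 * (S s + R s)"
    using kappa b1 power_increasing[of 3 6 \<kappa>] self_le_power[of b 2] by (intro mult_mono) auto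
  also have "\<kappa> * Y s + 2 * b\<^sup>2 * \<kappa>^6 * (S s + R s) = V s"
    unfolding Y_def state_bd_def by algebra
  finally show ?thesis by simp
qed

lemma ysur_le:
  assumes "\<And>s. Ns s \<in> Mset H b \<kappa> \<gamma>"
  shows "norm (ysur H A B K w Ns t) \<le> Y (int t)"
  unfolding ysur_eq using norm_state_le[where D = "\<lambda>s. dis (Ns s) s" and m = "Suc H"] norm_dis_le[OF assms]
  by (simp add: lessThan_Suc_atMost)

lemma vsur_le:
  assumes "\<And>s. Ns s \<in> Mset H b \<kappa> \<gamma>"
  shows "norm (vsur H A B K w Ns t) \<le> V (int t)"
  unfolding vsur_eq using ysur_le[OF assms] norm_dis_le[OF assms] by (intro norm_input_le)

lemma ut_eq: "ut t = - (K *v xt t) + dis (Mt t) (int t)"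
  unfolding dapu_def dist_input_def sum_1_shift by (simp add: algebra_simps)

text \<open>Both sides vanish for \<open>s \<le> 0\<close>, so \<open>unroll\<close> applies without
  comparing \<open>t\<close> with \<open>H\<close>.\<close>

lemma xt_rec: "wext xt s = (A - B ** K) *v wext xt (s - 1) + (wext w (s - 1) + B *v dis (Ms (s - 1)) (s - 1))"
proof (cases "s \<ge> 1")
  case True
  then obtain t where s: "s = int t + 1" by (metis add.commute diff_add_cancel int_nat_eq diff_ge_0_iff_ge)
  have "wext xt s = xt (Suc t)" unfolding s using wext_of_nat[of xt "Suc t"] by (simp add: add.commute)
  also have "\<dots> = A *v xt t + B *v ut t + w t" by simp
  finally show ?thesis
    unfolding ut_eq s
    by (simp add: matrix_vector_right_distrib matrix_vector_mult_diff_rdistrib matrix_vector_mult_diff_distrib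
        matrix_vector_mul_assoc[symmetric] algebra_simps del: dapx.simps)
next
  case False
  then show ?thesis by (cases "s = 0") (auto simp: wext_def dist_input_neg)
qed

lemma xt_eq: "xt t = Apow (Suc H) *v wext xt (int t - 1 - int H) + ysur H A B K w Ms t"
  using unroll[of "wext xt", OF xt_rec, of "int t" "Suc H"]
  by (simp add: ysur_eq lessThan_Suc_atMost algebra_simps del: dapx.simps)

lemma wext_xt_le: "norm (wext xt s) \<le> Y s"
proof -
  \<comment> \<open>The argument is 0 for nonnegative \<open>s\<close> and \<open>s\<close> itself
    otherwise; the extended state is zero in both cases.\<close>
  have "wext xt (s - int (nat s)) = 0" by (auto simp: wext_def)
  then have "wext xt s = (\<Sum>j<nat s. Apow j *v (wext w (s - 1 - int j) + B *v dis (Ms (s - 1 - int j)) (s - 1 - int j)))"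
    using unroll[of "wext xt", OF xt_rec, of s "nat s"] by simp
  also have "norm \<dots> \<le> Y s"
    by (rule norm_state_le) (rule norm_dis_le[OF Mt_in])
  finally show ?thesis .
qed

lemma xt_le: "norm (xt t) \<le> Y (int t)"
  using wext_xt_le[of "int t"] by simp

lemma ut_le: "norm (ut t) \<le> V (int t)"
  unfolding ut_eq using xt_le norm_dis_le[OF Mt_in] by (intro norm_input_le)

text \<open>Surrogate and true state differ by A_K^(H+1) applied to the state H + 1 steps back. The
  disturbance inputs agree, so the inputs differ by \<open>K\<close> times that.\<close>

lemma truncation_alg:
  "c t (xt t) (ut t) - Fsur c H A B K w t Ms
     \<le> \<rho> ^ H * (G * V (int t) * (2 * \<kappa>^3 * V (int t - 1 - int H)))"
proof -
  define e where "e = \<kappa>\<^sup>2 * \<rho> ^ Suc H * V (int t - 1 - int H)"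
  have e: "norm (xt t - ysur H A B K w Ms t) \<le> e"
    using norm_Apow_le[OF order_trans[OF wext_xt_le Y_le_V], of "Suc H" "int t - 1 - int H"] xt_eq[of t]
    unfolding e_def by (metis add_diff_cancel_right')
  have "norm (ut t - vsur H A B K w Ms t) \<le> \<kappa> * e"
    using norm_K_le[OF e] by (simp add: ut_eq vsur_eq matrix_vector_mult_diff_distrib norm_minus_commute)
  from cost_diff_le[OF A1 order_trans[OF xt_le Y_le_V] ut_le e this]
  have "c t (xt t) (ut t) - Fsur c H A B K w t Ms \<le> G * V (int t) * (e + \<kappa> * e)"
    by (simp add: Fsur_def)
  also have "\<dots> \<le> G * V (int t) * (\<rho> ^ H * (2 * \<kappa>^3 * V (int t - 1 - int H)))"
  proof (rule mult_left_mono)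
    have "e + \<kappa> * e \<le> 2 * \<kappa> * e"
      using kappa rho mult_right_mono[OF kappa, of e] by (simp add: e_def)
    also have "\<dots> = \<rho> * (\<rho> ^ H * (2 * \<kappa>^3 * V (int t - 1 - int H)))"
      by (simp add: e_def power2_eq_square power3_eq_cube)
    also have "\<dots> \<le> 1 * (\<rho> ^ H * (2 * \<kappa>^3 * V (int t - 1 - int H)))"
      using rho kappa by (intro mult_right_mono) auto
    finally show "e + \<kappa> * e \<le> \<rho> ^ H * (2 * \<kappa>^3 * V (int t - 1 - int H))" by simp
  qed (use G1 in auto)
  finally show ?thesis by (simp add: mult_ac)
qed

end

section \<open>The gradient of the surrogate cost\<close>

lemma linear_functional_inner:
  fixes L :: "'a::euclidean_space \<Rightarrow> real"
  assumes "linear L"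
  obtains g where "\<And>x. L x = g \<bullet> x"
proof
  show "L x = adjoint L 1 \<bullet> x" for x
    using adjoint_works[OF assms, of x 1] by (simp add: inner_commute)
qed

lemma norm_closest_point_le:
  fixes C :: "'a::euclidean_space set"
  assumes "convex C" "closed C" "z \<in> C"
  shows "norm (closest_point C x - z) \<le> norm (x - z)"
  using closest_point_lipschitz[OF assms(1,2), of x z] assms(3) by (auto simp: closest_point_self dist_norm)

context dap_system begin

text \<open>The surrogate is affine in a constant parameter; \<open>dy\<close> and \<open>dv\<close>
  are its linear responses to a change of block \<open>i\<close>.\<close>

definition dy :: "nat \<Rightarrow> nat \<Rightarrow> real^'nx^'nu \<Rightarrow> real^'nx" where
  "dy t i X = (\<Sum>j\<le>H. Apow j *v (B *v (X *v wext w (int t - 1 - int j - 1 - int i))))"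

definition dv :: "nat \<Rightarrow> nat \<Rightarrow> real^'nx^'nu \<Rightarrow> real^'nu" where
  "dv t i X = - (K *v dy t i X) + X *v wext w (int t - 1 - int i)"

lemma linear_dy: "linear (dy t i)"
proof (rule linearI)
  show "dy t i (X + Z) = dy t i X + dy t i Z" for X Z
    by (simp add: dy_def matrix_vector_mult_add_rdistrib matrix_vector_right_distrib sum.distrib)
  show "dy t i (r *\<^sub>R X) = r *\<^sub>R dy t i X" for r X
    by (simp add: dy_def scaleR_sum_right scaleR_matrix_vector_assoc[symmetric]
        matrix_vector_mult_scaleR)
qed

lemma linear_dv: "linear (dv t i)"
proof (rule linearI)
  show "dv t i (X + Z) = dv t i X + dv t i Z" for X Z
    by (simp add: dv_def linear_add[OF linear_dy] matrix_vector_mult_add_rdistrib matrix_vector_right_distrib)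
  show "dv t i (r *\<^sub>R X) = r *\<^sub>R dv t i X" for r X
    by (simp add: dv_def linear_scale[OF linear_dy] scaleR_matrix_vector_assoc[symmetric]
        matrix_vector_mult_scaleR scaleR_add_right scaleR_diff_right)
qed

lemma dis_diff: "dis M s - dis N s = (\<Sum>k<H. (M k - N k) *v wext w (s - 1 - int k))"
  by (simp add: dist_input_def sum_subtractf matrix_vector_mult_diff_rdistrib)

lemma ysur_diff: "ysur H A B K w Ns t - ysur H A B K w Ns' t = (\<Sum>j\<le>H. Apow j *v (B *v
    (\<Sum>k<H. (Ns (int t - 1 - int j) k - Ns' (int t - 1 - int j) k) *v wext w (int t - 1 - int j - 1 - int k))))"
  unfolding ysur_eq dis_diff[symmetric]
  by (simp add: sum_subtractf[symmetric] matrix_vector_mult_diff_distrib[symmetric])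

lemma ysur_const_diff:
  "ysur H A B K w (\<lambda>_. M) t - ysur H A B K w (\<lambda>_. N) t = (\<Sum>i<H. dy t i (M i - N i))"
  unfolding ysur_diff dy_def by (subst sum.swap) (simp add: matvec_sum)

lemma vsur_const_diff:
  "vsur H A B K w (\<lambda>_. M) t - vsur H A B K w (\<lambda>_. N) t = (\<Sum>i<H. dv t i (M i - N i))"
proof -
  have "vsur H A B K w (\<lambda>_. M) t - vsur H A B K w (\<lambda>_. N) t =
    - (K *v (ysur H A B K w (\<lambda>_. M) t - ysur H A B K w (\<lambda>_. N) t)) + (dis M (int t) - dis N (int t))"
    by (simp add: vsur_eq matrix_vector_mult_diff_distrib)
  then show ?thesis
    unfolding ysur_const_diff dis_diff dv_def by (simp add: sum.distrib sum_negf sum_subtractf matvec_sum)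
qed

lemma norm_dy_le: "norm (dy t i X) \<le> \<kappa>\<^sup>2 * b * S (int t - 1 - int i) * norm X"
proof -
  have "norm (dy t i X) \<le> (\<Sum>j\<le>H. \<kappa>\<^sup>2 * \<rho> ^ j * (b * (norm X * noise w (int t - 1 - int j - 1 - int i))))"
    unfolding dy_def noise_def
    by (intro order_trans[OF norm_sum sum_mono] norm_Apow_le norm_B_le norm_matvec_le_frobenius)
  also have "\<dots> = \<kappa>\<^sup>2 * b * norm X * (\<Sum>j<Suc H. \<rho> ^ j * noise w (int t - 1 - int i - 1 - int j))"
    by (simp add: sum_distrib_left lessThan_Suc_atMost algebra_simps del: sum.lessThan_Suc)
  also have "\<dots> \<le> \<kappa>\<^sup>2 * b * norm X * S (int t - 1 - int i)"
    by (intro mult_left_mono sum_noise_le) auto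
  finally show ?thesis by (simp add: mult_ac)
qed

lemma norm_dy_dv_le:
  "norm (dy t i X) + norm (dv t i X)
     \<le> 2 * \<kappa>^3 * b * (S (int t - 1 - int i) + noise w (int t - 1 - int i)) * norm X"
proof -
  let ?S = "S (int t - 1 - int i)" and ?a = "noise w (int t - 1 - int i)"
  let ?d = "\<kappa>\<^sup>2 * b * ?S * norm X"
  have "norm (dv t i X) \<le> \<kappa> * ?d + norm X * ?a"
    unfolding dv_def noise_def
    by (rule order_trans[OF norm_triangle_ineq], rule add_mono)
       (use norm_K_le[OF norm_dy_le] norm_matvec_le_frobenius in auto)
  moreover have "?d \<le> \<kappa> * ?d" using mult_right_mono[OF kappa, of ?d] by simp
  moreover have "1 * (norm X * ?a) \<le> (2 * \<kappa>^3 * b) * (norm X * ?a)"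
  proof (rule mult_right_mono)
    have "1 * 1 \<le> \<kappa>^3 * b" by (intro mult_mono) (use kappa b1 in auto)
    then show "1 \<le> 2 * \<kappa>^3 * b" by linarith
  qed simp
  moreover have "\<kappa> * ?d + \<kappa> * ?d + (2 * \<kappa>^3 * b) * (norm X * ?a) = 2 * \<kappa>^3 * b * (?S + ?a) * norm X"
    by algebra
  ultimately show ?thesis using norm_dy_le[of t i X] by linarith
qed

text \<open>f_t is a cost composed with an affine map, so its directional derivatives come from the
  cost gradient \<open>gx\<close>, \<open>gu\<close> via \<open>dy\<close> and \<open>dv\<close>.
  The partial derivatives in \<open>gradM\<close> are the entries of the Riesz vector of that
  functional. The tangent inequality allows any \<open>N\<close>, as convexity is global.\<close>

lemma gradM_props:
  assumes M: "M \<in> Mset H b \<kappa> \<gamma>"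
  shows "\<And>i. i < H \<Longrightarrow> norm (gradM H (f t) M i) \<le> gb t i"
    and "\<And>N. f t M - f t N \<le> (\<Sum>i<H. gradM H (f t) M i \<bullet> (M i - N i))"
proof -
  let ?y = "ysur H A B K w (\<lambda>_. M) t" and ?v = "vsur H A B K w (\<lambda>_. M) t"
  obtain gx gu where g:
    "((\<lambda>(x', u'). c t x' u') has_derivative (\<lambda>(dx, du). gx \<bullet> dx + gu \<bullet> du)) (at (?y, ?v))"
    "norm gx \<le> G * norm ?y" "norm gu \<le> G * norm ?v"
    "\<And>x' u'. c t ?y ?v - c t x' u' \<le> gx \<bullet> (?y - x') + gu \<bullet> (?v - u')"
    using cost_tangent[OF A1, of t ?y ?v] by metis
  define L where "L i X = gx \<bullet> dy t i X + gu \<bullet> dv t i X" for i X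
  have linL: "linear (L i)" for i
    unfolding L_def
    by (rule linearI) (simp_all add: linear_add[OF linear_dy] linear_add[OF linear_dv]
        linear_scale[OF linear_dy] linear_scale[OF linear_dv] inner_add_right algebra_simps)
  have deriv: "deriv (\<lambda>e. f t (M(i := M i + e *\<^sub>R E))) 0 = L i E" if i: "i < H" for i E
  proof -
    \<comment> \<open>Only block \<open>i\<close> changes; every other block contributes the value
      of a linear map at 0.\<close>
    have upd: "(\<Sum>k<H. h k ((M(i := M i + e *\<^sub>R E)) k - M k)) = h i (e *\<^sub>R E)"
      if "\<And>k. linear (h k)" for h :: "nat \<Rightarrow> real^'nx^'nu \<Rightarrow> 'z::real_vector" and e
    proof -
      have "(\<Sum>k<H. h k ((M(i := M i + e *\<^sub>R E)) k - M k)) = (\<Sum>k\<in>{i}. h k (e *\<^sub>R E))"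
        using i that by (intro sum.mono_neutral_cong_right) (auto simp: linear_0)
      then show ?thesis by simp
    qed
    have "ysur H A B K w (\<lambda>_. M(i := M i + e *\<^sub>R E)) t = ?y + e *\<^sub>R dy t i E" for e
      using ysur_const_diff[of "M(i := M i + e *\<^sub>R E)" t M] upd[of "dy t" e, OF linear_dy]
      by (simp add: linear_scale[OF linear_dy] algebra_simps)
    moreover have "vsur H A B K w (\<lambda>_. M(i := M i + e *\<^sub>R E)) t = ?v + e *\<^sub>R dv t i E" for e
      using vsur_const_diff[of "M(i := M i + e *\<^sub>R E)" t M] upd[of "dv t" e, OF linear_dv]
      by (simp add: linear_scale[OF linear_dv] algebra_simps)
    ultimately have eq: "f t (M(i := M i + e *\<^sub>R E)) =
        (\<lambda>(x', u'). c t x' u') ((?y, ?v) + e *\<^sub>R (dy t i E, dv t i E))" for e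
      by (simp add: fsur_def Fsur_def)
    have "((\<lambda>e. f t (M(i := M i + e *\<^sub>R E))) has_derivative
        (\<lambda>e. (\<lambda>(dx, du). gx \<bullet> dx + gu \<bullet> du) (e *\<^sub>R (dy t i E, dv t i E)))) (at 0)"
      unfolding eq
      by (rule has_derivative_compose[of "\<lambda>e. (?y, ?v) + e *\<^sub>R (dy t i E, dv t i E)" _ 0 UNIV])
         (use g(1) in \<open>auto intro!: derivative_eq_intros\<close>)
    then have "((\<lambda>e. f t (M(i := M i + e *\<^sub>R E))) has_field_derivative L i E) (at 0)"
      by (simp add: has_field_derivative_def L_def distrib_left[symmetric] mult.commute[of _ "_ + _"])
    then show ?thesis by (rule DERIV_imp_deriv)
  qed
  have rep: "L i X = gradM H (f t) M i \<bullet> X" if i: "i < H" for i X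
  proof -
    obtain \<Gamma> where \<Gamma>: "\<And>X. L i X = \<Gamma> \<bullet> X" using linear_functional_inner[OF linL] by metis
    have "gradM H (f t) M i = \<Gamma>"
    proof -
      have "\<Gamma> \<bullet> (\<chi> r' s'. if r' = r \<and> s' = s then 1 else 0) = \<Gamma> $ r $ s" for r s
      proof -
        have "(\<chi> r' s'. if r' = r \<and> s' = s then 1 else 0) = axis r (axis s (1::real))"
          by (auto simp: vec_eq_iff axis_def)
        then show ?thesis by (simp add: inner_axis)
      qed
      then show ?thesis by (simp add: gradM_def i deriv \<Gamma> vec_eq_iff)
    qed
    then show ?thesis by (simp add: \<Gamma>)
  qed
  have gn: "norm gx \<le> G * V (int t)" "norm gu \<le> G * V (int t)"
    using g(2,3) order_trans[OF ysur_le[OF M] Y_le_V, of t] vsur_le[OF M, of t] G1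
    by (auto intro: order_trans mult_left_mono)
  show "norm (gradM H (f t) M i) \<le> gb t i" if i: "i < H" for i
  proof -
    let ?g = "gradM H (f t) M i"
    \<comment> \<open>The functional is tested on its own representative, and one factor
      \<open>norm ?g\<close> is cancelled at the end.\<close>
    have "norm ?g * norm ?g = ?g \<bullet> ?g" by (simp add: norm_eq_sqrt_inner)
    also have "\<dots> = L i ?g" using rep[OF i] by simp
    also have "\<dots> \<le> norm gx * norm (dy t i ?g) + norm gu * norm (dv t i ?g)"
      unfolding L_def by (intro add_mono norm_cauchy_schwarz)
    also have "\<dots> \<le> G * V (int t) * norm (dy t i ?g) + G * V (int t) * norm (dv t i ?g)"
      using gn by (intro add_mono mult_right_mono) auto
    also have "\<dots> = G * V (int t) * (norm (dy t i ?g) + norm (dv t i ?g))"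
      by (simp add: distrib_left)
    also have "\<dots> \<le> G * V (int t) * (2 * \<kappa>^3 * b * (S (int t - 1 - int i) + noise w (int t - 1 - int i)) * norm ?g)"
      using G1 by (intro mult_left_mono norm_dy_dv_le) auto
    also have "\<dots> = gb t i * norm ?g" by (simp add: grad_bd_def)
    finally show ?thesis
      using kappa G1 by (cases "norm ?g = 0") (auto simp: grad_bd_def)
  qed
  show "f t M - f t N \<le> (\<Sum>i<H. gradM H (f t) M i \<bullet> (M i - N i))" for N
  proof -
    have "f t M - f t N \<le> gx \<bullet> (\<Sum>i<H. dy t i (M i - N i)) + gu \<bullet> (\<Sum>i<H. dv t i (M i - N i))"
      unfolding fsur_def Fsur_def ysur_const_diff[symmetric] vsur_const_diff[symmetric] by (rule g(4))
    also have "\<dots> = (\<Sum>i<H. L i (M i - N i))"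
      by (simp add: L_def inner_sum_right sum.distrib)
    finally show ?thesis by (simp add: rep)
  qed
qed

section \<open>Parameter drift and online gradient descent\<close>

lemma gb_nonneg [simp]: "0 \<le> gb t i"
  unfolding grad_bd_def using G1 kappa by simp

text \<open>The old block already lies in its ball and is its own projection, so nonexpansiveness
  leaves only the gradient step.\<close>

lemma step_le:
  assumes "i < H" shows "norm (Mt (Suc t) i - Mt t i) \<le> \<eta> * gb t i"
proof -
  let ?C = "spec_ball (2 * b * \<kappa>^3 * \<rho> ^ i) :: (real^'nx^'nu) set"
  have C: "Mt t i \<in> ?C" using Mt_in[of t] assms unfolding Mset_eq by simp
  have "norm (Mt (Suc t) i - Mt t i) \<le> norm ((Mt t i - \<eta> *\<^sub>R gradM H (f t) (Mt t) i) - Mt t i)"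
    unfolding Mt_Suc using assms norm_closest_point_le[OF spec_ball_facts(2,1) C] by presburger
  also have "\<dots> \<le> \<eta> * gb t i"
    using gradM_props(1)[OF Mt_in assms, of t t] eta by simp
  finally show ?thesis .
qed

lemma movement_le:
  assumes "i < H" "s \<le> t" shows "norm (Mt s i - Mt t i) \<le> (\<Sum>r\<in>{s..<t}. \<eta> * gb r i)"
  using assms(2)
proof (induction t rule: dec_induct)
  case (step t)
  have "norm (Mt s i - Mt (Suc t) i) \<le> norm (Mt s i - Mt t i) + norm (Mt (Suc t) i - Mt t i)"
    using norm_triangle_ineq[of "Mt s i - Mt t i" "Mt t i - Mt (Suc t) i"]
    by (simp add: norm_minus_commute del: dapM.simps)
  then show ?case using step step_le[OF assms(1), of t] by (simp del: dapM.simps)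
qed simp

text \<open>At time \<open>t\<close> both policies use the current parameter, so the inputs differ
  only through \<open>K\<close> acting on the difference of the states, which is controlled by the
  drift.\<close>

lemma memory_le: "Fsur c H A B K w t Ms - f t (Mt t) \<le> memory_bd G \<kappa> b \<rho> \<eta> H w t"
proof -
  define e where "e = (\<Sum>j\<le>H. \<kappa>\<^sup>2 * \<rho> ^ j * (b * (\<Sum>k<H. (\<Sum>s\<in>{nat (int t - 1 - int j)..<t}. \<eta> * gb s k)
           * noise w (int t - 1 - int j - 1 - int k))))"
  have e: "norm (ysur H A B K w Ms t - ysur H A B K w (\<lambda>_. Mt t) t) \<le> e"
    unfolding ysur_diff e_def noise_def
    by (intro order_trans[OF norm_sum sum_mono] norm_Apow_le norm_B_le
         order_trans[OF norm_matvec_le_frobenius mult_right_mono] movement_le) auto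
  then have e0: "0 \<le> e" using norm_ge_zero order_trans by blast
  have "norm (vsur H A B K w Ms t - vsur H A B K w (\<lambda>_. Mt t) t) \<le> \<kappa> * e"
    using norm_K_le[OF e] by (simp add: vsur_eq matrix_vector_mult_diff_distrib norm_minus_commute)
  from cost_diff_le[OF A1 order_trans[OF ysur_le[OF Mt_in] Y_le_V] vsur_le[OF Mt_in] e this]
  have "Fsur c H A B K w t Ms - f t (Mt t) \<le> G * V (int t) * (e + \<kappa> * e)"
    by (simp add: Fsur_def fsur_def)
  also have "\<dots> \<le> G * V (int t) * (2 * \<kappa> * e)"
    using mult_right_mono[OF kappa e0] G1 by (intro mult_left_mono) auto
  also have "\<dots> = memory_bd G \<kappa> b \<rho> \<eta> H w t"
    by (simp add: memory_bd_def e_def mult.assoc)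
  finally show ?thesis .
qed

text \<open>The potential is the squared Frobenius distance to \<open>N\<close>. Projection onto a
  set containing \<open>N\<close> does not increase it, and the cross term of the gradient step
  dominates the regret of the round.\<close>

lemma ogd:
  assumes N: "N \<in> Mset H b \<kappa> \<gamma>"
  shows "(\<Sum>t<T. f t (Mt t) - f t N)
    \<le> (\<Sum>i<H. (norm (M0 i - N i))\<^sup>2) / (2 * \<eta>) + (\<Sum>t<T. \<eta> / 2 * (\<Sum>i<H. (gb t i)\<^sup>2))"
proof -
  define \<phi> where "\<phi> t = (\<Sum>i<H. (norm (Mt t i - N i))\<^sup>2)" for t
  have step: "f t (Mt t) - f t N \<le> (\<phi> t - \<phi> (Suc t)) / (2 * \<eta>) + \<eta> / 2 * (\<Sum>i<H. (gb t i)\<^sup>2)" for t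
  proof -
    let ?g = "gradM H (f t) (Mt t)"
    have "\<phi> (Suc t) \<le> (\<Sum>i<H. (norm (Mt t i - N i))\<^sup>2 - 2 * \<eta> * (?g i \<bullet> (Mt t i - N i)) + \<eta>\<^sup>2 * (gb t i)\<^sup>2)"
      unfolding \<phi>_def
    proof (rule sum_mono)
      fix i assume "i \<in> {..<H}"
      then have i: "i < H" by simp
      let ?C = "spec_ball (2 * b * \<kappa>^3 * \<rho> ^ i) :: (real^'nx^'nu) set"
      have "N i \<in> ?C" using N i unfolding Mset_eq by simp
      then have "norm (Mt (Suc t) i - N i) \<le> norm ((Mt t i - \<eta> *\<^sub>R ?g i) - N i)"
        unfolding Mt_Suc using i norm_closest_point_le[OF spec_ball_facts(2,1)] by simp
      then have "(norm (Mt (Suc t) i - N i))\<^sup>2 \<le> (norm ((Mt t i - N i) - \<eta> *\<^sub>R ?g i))\<^sup>2"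
        by (intro power_mono) (simp_all add: algebra_simps)
      also have "\<dots> = (norm (Mt t i - N i))\<^sup>2 - 2 * \<eta> * (?g i \<bullet> (Mt t i - N i)) + \<eta>\<^sup>2 * (norm (?g i))\<^sup>2"
        unfolding power2_norm_eq_inner by (simp add: inner_diff_left inner_diff_right inner_commute power2_eq_square algebra_simps)
      also have "(norm (?g i))\<^sup>2 \<le> (gb t i)\<^sup>2"
        using gradM_props(1)[OF Mt_in i] by (intro power_mono) auto
      finally show "(norm (Mt (Suc t) i - N i))\<^sup>2 \<le>
          (norm (Mt t i - N i))\<^sup>2 - 2 * \<eta> * (?g i \<bullet> (Mt t i - N i)) + \<eta>\<^sup>2 * (gb t i)\<^sup>2"
        by (simp add: mult_left_mono)
    qed
    also have "\<dots> = \<phi> t - 2 * \<eta> * (\<Sum>i<H. ?g i \<bullet> (Mt t i - N i)) + \<eta>\<^sup>2 * (\<Sum>i<H. (gb t i)\<^sup>2)"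
      by (simp add: \<phi>_def sum.distrib sum_subtractf sum_distrib_left)
    finally have "2 * \<eta> * (\<Sum>i<H. ?g i \<bullet> (Mt t i - N i)) \<le> \<phi> t - \<phi> (Suc t) + \<eta>\<^sup>2 * (\<Sum>i<H. (gb t i)\<^sup>2)"
      by linarith
    moreover have "2 * \<eta> * (f t (Mt t) - f t N) \<le> 2 * \<eta> * (\<Sum>i<H. ?g i \<bullet> (Mt t i - N i))"
      using eta by (intro mult_left_mono gradM_props(2)[OF Mt_in]) auto
    ultimately have "2 * \<eta> * (f t (Mt t) - f t N) \<le> \<phi> t - \<phi> (Suc t) + \<eta>\<^sup>2 * (\<Sum>i<H. (gb t i)\<^sup>2)"
      by linarith
    then have "f t (Mt t) - f t N \<le> (\<phi> t - \<phi> (Suc t) + \<eta>\<^sup>2 * (\<Sum>i<H. (gb t i)\<^sup>2)) / (2 * \<eta>)"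
      using eta by (subst pos_le_divide_eq) (auto simp: mult.commute)
    also have "\<dots> = (\<phi> t - \<phi> (Suc t)) / (2 * \<eta>) + \<eta> / 2 * (\<Sum>i<H. (gb t i)\<^sup>2)"
      using eta by (simp add: add_divide_distrib power2_eq_square)
    finally show ?thesis .
  qed
  have "(\<Sum>t<T. f t (Mt t) - f t N)
    \<le> (\<Sum>t<T. (\<phi> t - \<phi> (Suc t)) / (2 * \<eta>) + \<eta> / 2 * (\<Sum>i<H. (gb t i)\<^sup>2))"
    by (intro sum_mono step)
  also have "\<dots> = (\<phi> 0 - \<phi> T) / (2 * \<eta>) + (\<Sum>t<T. \<eta> / 2 * (\<Sum>i<H. (gb t i)\<^sup>2))"
    by (simp add: sum.distrib sum_divide_distrib[symmetric] sum_lessThan_telescope')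
  also have "(\<phi> 0 - \<phi> T) / (2 * \<eta>) \<le> \<phi> 0 / (2 * \<eta>)"
    using eta by (intro divide_right_mono) (auto simp: \<phi>_def sum_nonneg)
  finally show ?thesis by (simp add: \<phi>_def)
qed

end

section \<open>Imitating a linear controller by a disturbance-action policy\<close>

lemma matvec_minus: "(M::real^'c^'r) *v (- x) = - (M *v x)"
  by (rule linear_neg) (rule matrix_vector_mul_linear)

lemma lin_state_rec:
  "wext (linx A B K' w) s = (A - B ** K') *v wext (linx A B K' w) (s - 1) + wext w (s - 1)"
proof (cases "s \<ge> 1")
  case True
  then obtain t where s: "s = int t + 1" by (metis add.commute diff_add_cancel int_nat_eq diff_ge_0_iff_ge)
  have "wext (linx A B K' w) s = linx A B K' w (Suc t)"
    unfolding s using wext_of_nat[of "linx A B K' w" "Suc t"] by (simp add: add.commute)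
  then show ?thesis
    by (simp add: s matvec_minus matrix_vector_right_distrib matrix_vector_mult_diff_rdistrib matrix_vector_mult_diff_distrib
        matrix_vector_mul_assoc[symmetric])
next
  case False
  then show ?thesis by (cases "s = 0") (auto simp: wext_def)
qed

context dap_system begin

lemma norm_lin_state_le:
  assumes K': "strongly_stable \<kappa> \<gamma> A B K'"
  shows "norm (wext (linx A B K' w) s) \<le> \<kappa>\<^sup>2 * S s"
proof -
  let ?X = "wext (linx A B K' w)"
  have rec: "?X s = (A - B ** K') *v ?X (s - 1) + wext w (s - 1)" for s
    by (rule lin_state_rec)
  have "?X (s - int (nat s)) = 0" by (auto simp: wext_def)
  then have "?X s = (\<Sum>j<nat s. matpow (A - B ** K') j *v wext w (s - 1 - int j))"
    using unroll[of ?X, OF rec, of s "nat s"] by simp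
  also have "norm \<dots> \<le> (\<Sum>j<nat s. \<kappa>\<^sup>2 * \<rho> ^ j * noise w (s - 1 - int j))"
    unfolding noise_def by (intro order_trans[OF norm_sum sum_mono] strongly_stable_matpow[OF K'])
  also have "\<dots> = \<kappa>\<^sup>2 * (\<Sum>j<nat s. \<rho> ^ j * noise w (s - 1 - int j))"
    by (simp add: sum_distrib_left mult.assoc)
  also have "\<dots> \<le> \<kappa>\<^sup>2 * S s"
    by (intro mult_left_mono sum_noise_le) auto
  finally show ?thesis .
qed

text \<open>Since -K'x = -Kx + (K - K')x, the \<open>K'\<close> loop is a \<open>K\<close> loop with
  disturbance input (K - K')x. Expanding that x in the noise along A - BK' gives the policy
  \<open>N\<close> plus a tail of order \<rho>^H. The norm of K - K' is at most 2\<kappa>, which is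
  where the radius 2\<kappa>^3\<rho>^i comes from.\<close>

lemma comparator:
  assumes K': "strongly_stable \<kappa> \<gamma> A B K'"
  obtains N where "N \<in> Mset H b \<kappa> \<gamma>"
    "\<And>t. f t N - c t (linx A B K' w t) (- (K' *v linx A B K' w t))
      \<le> \<rho> ^ H * (G * V (int t) * (4 * \<kappa>^8 * b *
          (S (int t - 1 - int H) + R (int t - int H) + S (int t - int H))))"
proof -
  let ?X = "wext (linx A B K' w)"
  let ?P = "matpow (A - B ** K')"
  define N :: "('nx,'nu) dap" where "N = (\<lambda>k. if k < H then (K - K') ** ?P k else 0)"
  have nKK: "norm ((K - K') *v x) \<le> 2 * \<kappa> * norm x" for x
    using norm_triangle_ineq4[of "K *v x" "K' *v x"] norm_K[of x]
      norm_matvec_le_of_spec_norm_le[OF strongly_stable_gain[OF K'], of x]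
    by (simp add: matrix_vector_mult_diff_rdistrib)
  have nKP: "norm ((K - K') *v (?P k *v x)) \<le> 2 * \<kappa> * (\<kappa>\<^sup>2 * \<rho> ^ k * norm x)" for k x
    by (rule order_trans[OF nKK mult_left_mono[OF strongly_stable_matpow[OF K']]]) (use kappa in auto)
  have N: "N \<in> Mset H b \<kappa> \<gamma>"
  proof -
    have "spec_norm ((K - K') ** ?P k) \<le> 2 * b * \<kappa>^3 * \<rho> ^ k" for k
      unfolding spec_norm_le_iff[OF radius_nonneg]
    proof
      fix x
      have "norm (((K - K') ** ?P k) *v x) \<le> 1 * (2 * \<kappa> * (\<kappa>\<^sup>2 * \<rho> ^ k * norm x))"
        using nKP by (simp add: matrix_vector_mul_assoc)
      also have "\<dots> \<le> b * (2 * \<kappa> * (\<kappa>\<^sup>2 * \<rho> ^ k * norm x))"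
        using kappa rho by (intro mult_right_mono b1) auto
      also have "\<dots> = 2 * b * \<kappa>^3 * \<rho> ^ k * norm x" by algebra
      finally show "norm (((K - K') ** ?P k) *v x) \<le> 2 * b * \<kappa>^3 * \<rho> ^ k * norm x" .
    qed
    then show ?thesis by (simp add: Mset_def N_def)
  qed
  have rec: "?X s = (A - B ** K') *v ?X (s - 1) + wext w (s - 1)" for s
    by (rule lin_state_rec)
  \<comment> \<open>The part of (K - K')x due to noise of lag beyond \<open>H\<close>, which
    \<open>N\<close> cannot reproduce.\<close>
  define q where "q s = (K - K') *v (?P H *v ?X (s - int H))" for s
  have disN: "dis N s = (K - K') *v ?X s - q s" for s
  proof -
    have "dis N s = (K - K') *v (\<Sum>k<H. ?P k *v wext w (s - 1 - int k))"
      by (simp add: dist_input_def N_def matvec_sum matrix_vector_mul_assoc)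
    also have "(\<Sum>k<H. ?P k *v wext w (s - 1 - int k)) = ?X s - ?P H *v ?X (s - int H)"
      using unroll[of ?X, OF rec, of s H] by (simp add: algebra_simps)
    finally show ?thesis by (simp add: q_def matrix_vector_mult_diff_distrib)
  qed
  have q: "norm (q s) \<le> \<rho> ^ H * (2 * \<kappa>^5 * S (s - int H))" for s
  proof -
    have "norm (q s) \<le> 2 * \<kappa> * (\<kappa>\<^sup>2 * \<rho> ^ H * norm (?X (s - int H)))"
      unfolding q_def by (rule nKP)
    also have "\<dots> \<le> 2 * \<kappa> * (\<kappa>\<^sup>2 * \<rho> ^ H * (\<kappa>\<^sup>2 * S (s - int H)))"
      using kappa rho by (intro mult_left_mono norm_lin_state_le[OF K']) auto
    also have "\<dots> = \<rho> ^ H * (2 * \<kappa>^5 * S (s - int H))" by algebra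
    finally show ?thesis .
  qed
  have rec2: "?X s = (A - B ** K) *v ?X (s - 1) + (wext w (s - 1) + B *v ((K - K') *v ?X (s - 1)))" for s
    by (subst rec)
       (simp add: matrix_vector_mult_diff_rdistrib matrix_vector_mult_diff_distrib
        matrix_vector_mul_assoc[symmetric])
  have "f t N - c t (linx A B K' w t) (- (K' *v linx A B K' w t))
      \<le> \<rho> ^ H * (G * V (int t) * (4 * \<kappa>^8 * b *
          (S (int t - 1 - int H) + R (int t - int H) + S (int t - int H))))" for t
  proof -
    let ?x = "linx A B K' w t" and ?y = "ysur H A B K w (\<lambda>_. N) t"
    let ?S1 = "S (int t - 1 - int H)" and ?R = "R (int t - int H)" and ?S2 = "S (int t - int H)"
    define e where "e = \<rho> ^ H * (\<kappa>^4 * ?S1 + 2 * \<kappa>^7 * b * ?R)"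
    have xy: "?x - ?y = Apow (Suc H) *v ?X (int t - 1 - int H)
        + (\<Sum>j\<le>H. Apow j *v (B *v q (int t - 1 - int j)))"
    proof -
      have "?x = Apow (Suc H) *v ?X (int t - 1 - int H) + (\<Sum>j\<le>H. Apow j *v
          (wext w (int t - 1 - int j) + B *v ((K - K') *v ?X (int t - 1 - int j))))"
        using unroll[of ?X, OF rec2, of "int t" "Suc H"]
        by (simp add: lessThan_Suc_atMost algebra_simps del: linx.simps)
      moreover have "?y = (\<Sum>j\<le>H. Apow j *v (wext w (int t - 1 - int j)
           + (B *v ((K - K') *v ?X (int t - 1 - int j)) - B *v q (int t - 1 - int j))))"
        by (simp only: ysur_eq disN matrix_vector_mult_diff_distrib[symmetric])
      moreover have "(\<Sum>j\<le>H. Apow j *v (a j + g j)) - (\<Sum>j\<le>H. Apow j *v (a j + (g j - h j))) = (\<Sum>j\<le>H. Apow j *v h j)"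
        for a g h :: "nat \<Rightarrow> real^'nx"
        by (simp add: sum_subtractf[symmetric] matrix_vector_mult_diff_distrib[symmetric])
      ultimately show ?thesis by (simp only: add_diff_eq[symmetric])
    qed
    have "norm (Apow (Suc H) *v ?X (int t - 1 - int H)) \<le> \<kappa>\<^sup>2 * \<rho> ^ Suc H * (\<kappa>\<^sup>2 * ?S1)"
      by (intro norm_Apow_le norm_lin_state_le K')
    also have "\<dots> = \<rho> * (\<rho> ^ H * (\<kappa>^4 * ?S1))" by (simp add: power4_eq_xxxx power2_eq_square)
    also have "\<dots> \<le> 1 * (\<rho> ^ H * (\<kappa>^4 * ?S1))"
      using rho by (intro mult_right_mono) auto
    finally have e1: "norm (Apow (Suc H) *v ?X (int t - 1 - int H)) \<le> \<rho> ^ H * (\<kappa>^4 * ?S1)" by simp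
    have "norm (\<Sum>j\<le>H. Apow j *v (B *v q (int t - 1 - int j)))
        \<le> (\<Sum>j\<le>H. \<kappa>\<^sup>2 * \<rho> ^ j * (b * (\<rho> ^ H * (2 * \<kappa>^5 * S (int t - 1 - int j - int H)))))"
      by (intro order_trans[OF norm_sum sum_mono] norm_Apow_le norm_B_le q)
    also have "\<dots> = \<rho> ^ H * (2 * \<kappa>^7 * b * (\<Sum>j<Suc H. \<rho> ^ j * S (int t - int H - 1 - int j)))"
    proof -
      have "\<kappa>\<^sup>2 * \<rho> ^ j * (b * (\<rho> ^ H * (2 * \<kappa>^5 * S (int t - 1 - int j - int H))))
         = \<rho> ^ H * (2 * \<kappa>^7 * b) * (\<rho> ^ j * S (int t - int H - 1 - int j))" for j
      proof -
        have "int t - 1 - int j - int H = int t - int H - 1 - int j" by simp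
        moreover have "\<kappa>\<^sup>2 * r * (b * (p * (2 * \<kappa>^5 * z))) = p * (2 * \<kappa>^7 * b) * (r * z)" for p r z by algebra
        ultimately show ?thesis by presburger
      qed
      then show ?thesis by (simp only: sum_distrib_left lessThan_Suc_atMost mult.assoc)
    qed
    also have "\<dots> \<le> \<rho> ^ H * (2 * \<kappa>^7 * b * ?R)"
      using kappa rho by (intro mult_left_mono sum_S_le) auto
    finally have e2: "norm (\<Sum>j\<le>H. Apow j *v (B *v q (int t - 1 - int j))) \<le> \<rho> ^ H * (2 * \<kappa>^7 * b * ?R)" .
    have "norm (?x - ?y) \<le> e"
      unfolding xy e_def distrib_left by (rule order_trans[OF norm_triangle_ineq add_mono[OF e1 e2]])
    then have e: "norm (?y - ?x) \<le> e" by (simp add: norm_minus_commute)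
    have "norm (vsur H A B K w (\<lambda>_. N) t - (- (K' *v ?x))) \<le> \<kappa> * e + \<rho> ^ H * (2 * \<kappa>^5 * ?S2)"
    proof -
      have "vsur H A B K w (\<lambda>_. N) t - (- (K' *v ?x)) = - (K *v (?y - ?x)) - q (int t)"
        by (simp add: vsur_eq disN matrix_vector_mult_diff_distrib matrix_vector_mult_diff_rdistrib del: linx.simps)
      then show ?thesis
        using norm_triangle_ineq4[of "- (K *v (?y - ?x))" "q (int t)"] norm_K_le[OF e] q[of "int t"] by simp
    qed
    from cost_diff_le[OF A1 order_trans[OF ysur_le[OF N] Y_le_V] vsur_le[OF N] e this]
    have "f t N - c t ?x (- (K' *v ?x)) \<le> G * V (int t) * (e + (\<kappa> * e + \<rho> ^ H * (2 * \<kappa>^5 * ?S2)))"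
      by (simp add: fsur_def Fsur_def)
    also have "\<dots> \<le> G * V (int t) * (\<rho> ^ H * (4 * \<kappa>^8 * b * (?S1 + ?R + ?S2)))"
    proof (rule mult_left_mono)
      \<comment> \<open>The three error terms get one common coefficient; the largest is
        \<open>2 * \<kappa> * (2 * \<kappa>^7 * b)\<close>, from the tail passing through
        \<open>B\<close> and \<open>K\<close>.\<close>
      have pw: "\<kappa>^5 \<le> \<kappa>^8 * b"
        using mult_mono[of "\<kappa>^5" "\<kappa>^8" 1 b] kappa by (simp add: power_increasing)
      have e0: "0 \<le> e" using e norm_ge_zero order_trans by blast
      have "e + (\<kappa> * e + \<rho> ^ H * (2 * \<kappa>^5 * ?S2)) \<le> 2 * \<kappa> * e + \<rho> ^ H * (2 * \<kappa>^5 * ?S2)"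
        using mult_right_mono[OF kappa e0] by simp
      also have "\<dots> = \<rho> ^ H * (2 * \<kappa>^5 * ?S1 + 4 * (\<kappa>^8 * b) * ?R + 2 * \<kappa>^5 * ?S2)"
        unfolding e_def by algebra
      also have "\<dots> \<le> \<rho> ^ H * (4 * (\<kappa>^8 * b) * ?S1 + 4 * (\<kappa>^8 * b) * ?R + 4 * (\<kappa>^8 * b) * ?S2)"
      proof -
        have "2 * \<kappa>^5 \<le> 4 * (\<kappa>^8 * b)"
          using pw kappa by (smt (verit) zero_le_power)
        then show ?thesis
          using rho by (intro mult_left_mono add_mono mult_right_mono) auto
      qed
      also have "\<dots> = \<rho> ^ H * (4 * \<kappa>^8 * b * (?S1 + ?R + ?S2))" by algebra
      finally show "e + (\<kappa> * e + \<rho> ^ H * (2 * \<kappa>^5 * ?S2)) \<le> \<rho> ^ H * (4 * \<kappa>^8 * b * (?S1 + ?R + ?S2))" .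
    qed (use G1 in auto)
    finally show ?thesis by (simp only: mult_ac)
  qed
  with N that show thesis by blast
qed

text \<open>Spectral radii give the distance of the blocks; passing to the Frobenius norm costs the
  number of columns, which is at most \<open>n\<close>.\<close>

lemma diameter_le:
  assumes "N \<in> Mset H b \<kappa> \<gamma>"
  shows "(\<Sum>i<H. (norm (M0 i - N i))\<^sup>2) \<le> 16 * real CARD('nx) * b\<^sup>2 * \<kappa>^6 / \<gamma>\<^sup>2"
proof -
  have "(norm (M0 i - N i))\<^sup>2 \<le> 16 * real CARD('nx) * b\<^sup>2 * \<kappa>^6 * \<rho> ^ i" if i: "i < H" for i
  proof -
    have "norm ((M0 i - N i) *v x) \<le> 4 * b * \<kappa>^3 * \<rho> ^ i * norm x" for x
      using norm_triangle_ineq4[of "M0 i *v x" "N i *v x"] Mset_bound[OF M0 i, of x] Mset_bound[OF assms i, of x]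
      by (simp add: matrix_vector_mult_diff_rdistrib)
    from frobenius_le_spec_norm[OF this]
    have "(norm (M0 i - N i))\<^sup>2 \<le> real CARD('nx) * (4 * b * \<kappa>^3 * \<rho> ^ i)\<^sup>2" .
    also have "\<dots> = 16 * real CARD('nx) * b\<^sup>2 * \<kappa>^6 * \<rho> ^ i * \<rho> ^ i" by algebra
    also have "\<dots> \<le> 16 * real CARD('nx) * b\<^sup>2 * \<kappa>^6 * \<rho> ^ i * 1"
      using rho kappa by (intro mult_left_mono power_le_one) auto
    finally show ?thesis by simp
  qed
  then have "(\<Sum>i<H. (norm (M0 i - N i))\<^sup>2) \<le> (\<Sum>i<H. 16 * real CARD('nx) * b\<^sup>2 * \<kappa>^6 * \<rho> ^ i)"
    by (intro sum_mono) auto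
  also have "\<dots> = 16 * real CARD('nx) * b\<^sup>2 * \<kappa>^6 * (\<Sum>i<H. \<rho> ^ i)"
    by (simp add: sum_distrib_left)
  also have "\<dots> \<le> 16 * real CARD('nx) * b\<^sup>2 * \<kappa>^6 * (1 / \<gamma>\<^sup>2)"
  proof (rule mult_left_mono)
    \<comment> \<open>Weakened so that the bound becomes at most the square of
      \<open>D\<close>.\<close>
    have "1 / \<gamma> \<le> 1 / \<gamma>\<^sup>2" using gamma by (intro divide_left_mono) (auto simp: power2_eq_square mult_left_le)
    then show "(\<Sum>i<H. \<rho> ^ i) \<le> 1 / \<gamma>\<^sup>2" using sum_geometric_le[OF gamma, of H] by linarith
  qed (use kappa in simp)
  finally show ?thesis by simp
qed

text \<open>The intermediate costs are F_t along the actual parameters, f_t(M_t) and f_t(N). No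
  quantity on the right depends on \<open>K'\<close>.\<close>

theorem pathwise_regret:
  assumes K': "strongly_stable \<kappa> \<gamma> A B K'"
  shows "dap_cost c H \<kappa> \<gamma> (\<lambda>_. \<eta>) A B K M0 w T - lin_cost c A B K' w T
    \<le> 16 * real CARD('nx) * b\<^sup>2 * \<kappa>^6 / \<gamma>\<^sup>2 / (2 * \<eta>)
      + (\<Sum>t<T. \<eta> / 2 * (\<Sum>i<H. (gb t i)\<^sup>2) + memory_bd G \<kappa> b \<rho> \<eta> H w t + trunc_bd G \<kappa> b \<rho> H w t)"
proof -
  obtain N where N: "N \<in> Mset H b \<kappa> \<gamma>" and comp:
    "\<And>t. f t N - c t (linx A B K' w t) (- (K' *v linx A B K' w t))
      \<le> \<rho> ^ H * (G * V (int t) * (4 * \<kappa>^8 * b *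
          (S (int t - 1 - int H) + R (int t - int H) + S (int t - int H))))"
    using comparator[OF K'] by metis
  have "dap_cost c H \<kappa> \<gamma> (\<lambda>_. \<eta>) A B K M0 w T - lin_cost c A B K' w T
    = (\<Sum>t<T. c t (xt t) (ut t) - c t (linx A B K' w t) (- (K' *v linx A B K' w t)))"
    by (simp add: dap_cost_def lin_cost_def sum_subtractf)
  also have "\<dots> \<le> (\<Sum>t<T. (f t (Mt t) - f t N) + (memory_bd G \<kappa> b \<rho> \<eta> H w t + trunc_bd G \<kappa> b \<rho> H w t))"
  proof (rule sum_mono)
    fix t
    show "c t (xt t) (ut t) - c t (linx A B K' w t) (- (K' *v linx A B K' w t))
      \<le> (f t (Mt t) - f t N) + (memory_bd G \<kappa> b \<rho> \<eta> H w t + trunc_bd G \<kappa> b \<rho> H w t)"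
      using truncation_alg[of t] memory_le[of t] comp[of t] unfolding trunc_bd_def distrib_left
      by linarith
  qed
  also have "\<dots> = (\<Sum>t<T. f t (Mt t) - f t N)
      + (\<Sum>t<T. memory_bd G \<kappa> b \<rho> \<eta> H w t + trunc_bd G \<kappa> b \<rho> H w t)"
    by (simp add: sum.distrib)
  also have "(\<Sum>t<T. f t (Mt t) - f t N) \<le> 16 * real CARD('nx) * b\<^sup>2 * \<kappa>^6 / \<gamma>\<^sup>2 / (2 * \<eta>)
      + (\<Sum>t<T. \<eta> / 2 * (\<Sum>i<H. (gb t i)\<^sup>2))"
    using ogd[OF N, of T] divide_right_mono[OF diameter_le[OF N], of "2 * \<eta>"] eta by linarith
  finally show ?thesis by (simp add: sum.distrib algebra_simps)
qed

end

section \<open>Expected size of the pathwise bound\<close>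

locale noise_process = prob_space M for M :: "'w measure" +
  fixes W :: "nat \<Rightarrow> 'w \<Rightarrow> real^'nx" and \<sigma> \<kappa> \<gamma> b G :: real
  assumes W_meas [measurable]: "\<And>t. W t \<in> borel_measurable M"
    and sigma: "0 \<le> \<sigma>"
    and W_moment: "\<And>t. (\<integral>\<^sup>+\<omega>. ennreal ((norm (W t \<omega>)) ^ 4) \<partial>M) \<le> ennreal (\<sigma> ^ 4)"
    and kappa: "1 \<le> \<kappa>" and gamma: "0 < \<gamma>" "\<gamma> < 1" and b: "1 \<le> b" and G: "1 \<le> G"
begin

abbreviation "Wp \<omega> \<equiv> (\<lambda>t. W t \<omega>)"
abbreviation "\<rho> \<equiv> 1 - \<gamma>"

lemma L4_noise: "L4_bdd (\<lambda>\<omega>. noise (Wp \<omega>) s) \<sigma>"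
proof (cases "s < 0")
  case True
  then show ?thesis using L4_bdd_mono[OF L4_bdd_zero sigma] by (simp add: noise_def)
next
  case False
  then show ?thesis using W_moment sigma by (simp add: noise_def wext_def L4_bdd_def)
qed

text \<open>The triangle inequality in L^4 with weights of total mass at most 1/\<gamma>, valid for
  arbitrarily correlated noise.\<close>

lemma L4_geom_conv:
  assumes "\<And>s. L4_bdd (\<lambda>\<omega>. X \<omega> s) q"
  shows "L4_bdd (\<lambda>\<omega>. geom_conv \<rho> (X \<omega>) s) (q / \<gamma>)"
proof -
  have q: "0 \<le> q" using assms[of 0] by (simp add: L4_bdd_def)
  have "L4_bdd (\<lambda>\<omega>. geom_conv \<rho> (X \<omega>) s) (\<Sum>j<nat s. \<rho> ^ j * q)"
    unfolding geom_conv_def using gamma by (intro L4_bdd_sum L4_bdd_cmult assms) auto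
  moreover have "(\<Sum>j<nat s. \<rho> ^ j * q) \<le> q / \<gamma>"
    using mult_right_mono[OF sum_geometric_le[OF gamma, of "nat s"] q] by (simp add: sum_distrib_right)
  ultimately show ?thesis by (rule L4_bdd_mono)
qed

lemma L4_filt: "L4_bdd (\<lambda>\<omega>. filt \<rho> (Wp \<omega>) s) (\<sigma> / \<gamma>)"
  unfolding filt_def by (rule L4_geom_conv[OF L4_noise])

lemma L4_filt2: "L4_bdd (\<lambda>\<omega>. filt2 \<rho> (Wp \<omega>) s) (\<sigma> / \<gamma>\<^sup>2)"
proof -
  have "L4_bdd (\<lambda>\<omega>. filt2 \<rho> (Wp \<omega>) s) (\<sigma> / \<gamma> / \<gamma>)"
    unfolding filt2_def by (rule L4_geom_conv) (rule L4_filt)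
  then show ?thesis by (simp add: power2_eq_square)
qed

lemma inv_gamma: "\<sigma> \<le> \<sigma> / \<gamma>" "\<sigma> / \<gamma> \<le> \<sigma> / \<gamma>\<^sup>2"
  using gamma sigma by (auto simp: field_simps power2_eq_square mult_left_le_one_le)

text \<open>\<open>vq\<close> and \<open>pq\<close> bound the L^4 norms of \<open>state_bd\<close>
  and of \<open>sens\<close>.\<close>

definition "vq = 8 * \<kappa>^6 * b\<^sup>2 * (\<sigma> / \<gamma>\<^sup>2)"
definition "pq = 4 * \<kappa>^3 * b * (\<sigma> / \<gamma>)"

lemma vq_pq_nonneg: "0 \<le> vq" "0 \<le> pq"
  using kappa b sigma gamma by (auto simp: vq_def pq_def)

lemma L4_state: "L4_bdd (\<lambda>\<omega>. state_bd \<kappa> b \<rho> (Wp \<omega>) s) vq"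
proof -
  have "L4_bdd (\<lambda>\<omega>. state_bd \<kappa> b \<rho> (Wp \<omega>) s) (4 * \<kappa>^6 * b\<^sup>2 * (\<sigma> / \<gamma> + \<sigma> / \<gamma>\<^sup>2))"
    unfolding state_bd_def using kappa by (intro L4_bdd_cmult L4_bdd_add L4_filt L4_filt2) auto
  moreover have "4 * \<kappa>^6 * b\<^sup>2 * (\<sigma> / \<gamma> + \<sigma> / \<gamma>\<^sup>2) \<le> 4 * \<kappa>^6 * b\<^sup>2 * (2 * (\<sigma> / \<gamma>\<^sup>2))"
    by (rule mult_left_mono) (use inv_gamma(2) kappa in auto)
  ultimately have "L4_bdd (\<lambda>\<omega>. state_bd \<kappa> b \<rho> (Wp \<omega>) s) (4 * \<kappa>^6 * b\<^sup>2 * (2 * (\<sigma> / \<gamma>\<^sup>2)))"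
    by (rule L4_bdd_mono)
  then show ?thesis by (simp add: vq_def mult.assoc)
qed

text \<open>Split off from \<open>grad_bd\<close> so that a gradient bound is visibly a product of
  two L^4 quantities.\<close>

definition sens :: "(nat \<Rightarrow> real^'nx) \<Rightarrow> nat \<Rightarrow> nat \<Rightarrow> real" where
  "sens w t i = 2 * \<kappa>^3 * b * (filt \<rho> w (int t - 1 - int i) + noise w (int t - 1 - int i))"

lemma grad_bd_eq: "grad_bd G \<kappa> b \<rho> w t i = G * (state_bd \<kappa> b \<rho> w (int t) * sens w t i)"
  by (simp add: grad_bd_def sens_def)

lemma L4_sens: "L4_bdd (\<lambda>\<omega>. sens (Wp \<omega>) t i) pq"
proof -
  have "L4_bdd (\<lambda>\<omega>. sens (Wp \<omega>) t i) (2 * \<kappa>^3 * b * (\<sigma> / \<gamma> + \<sigma>))"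
    unfolding sens_def using kappa b by (intro L4_bdd_cmult L4_bdd_add L4_filt L4_noise) auto
  moreover have "2 * \<kappa>^3 * b * (\<sigma> / \<gamma> + \<sigma>) \<le> 2 * \<kappa>^3 * b * (2 * (\<sigma> / \<gamma>))"
    by (rule mult_left_mono) (use inv_gamma(1) kappa b in auto)
  ultimately have "L4_bdd (\<lambda>\<omega>. sens (Wp \<omega>) t i) (2 * \<kappa>^3 * b * (2 * (\<sigma> / \<gamma>)))"
    by (rule L4_bdd_mono)
  then show ?thesis by (simp add: pq_def mult.assoc)
qed

lemma mean_grad:
  assumes "0 \<le> \<eta>"
  shows "mean_bdd (\<lambda>\<omega>. \<eta> / 2 * (\<Sum>i<H. (grad_bd G \<kappa> b \<rho> (Wp \<omega>) t i)\<^sup>2))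
    (\<eta> / 2 * (real H * (G\<^sup>2 * (vq * pq * (vq * pq)))))"
proof -
  have eq: "(grad_bd G \<kappa> b \<rho> w t i)\<^sup>2
      = G\<^sup>2 * (state_bd \<kappa> b \<rho> w (int t) * sens w t i * (state_bd \<kappa> b \<rho> w (int t) * sens w t i))"
    for w :: "nat \<Rightarrow> real^'nx" and i
    by (simp add: grad_bd_eq power2_eq_square)
  have "mean_bdd (\<lambda>\<omega>. (grad_bd G \<kappa> b \<rho> (Wp \<omega>) t i)\<^sup>2) (G\<^sup>2 * (vq * pq * (vq * pq)))" for i
    unfolding eq by (intro mean_bdd_cmult L4_bdd_prod4 L4_state L4_sens) simp
  then have "mean_bdd (\<lambda>\<omega>. \<eta> / 2 * (\<Sum>i<H. (grad_bd G \<kappa> b \<rho> (Wp \<omega>) t i)\<^sup>2))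
    (\<eta> / 2 * (\<Sum>i<H. G\<^sup>2 * (vq * pq * (vq * pq))))"
    using assms by (intro mean_bdd_cmult mean_bdd_sum) auto
  then show ?thesis by simp
qed

text \<open>After expansion every summand is state * noise * (state * sensitivity). The drift window
  of lag \<open>j\<close> has at most j + 1 steps, so the weights form an arithmetic-geometric
  series, whence the square of \<gamma>.\<close>

lemma mean_memory:
  assumes "0 \<le> \<eta>"
  shows "mean_bdd (\<lambda>\<omega>. memory_bd G \<kappa> b \<rho> \<eta> H (Wp \<omega>) t)
    (2 * \<kappa>^3 * b * G\<^sup>2 * \<eta> * real H * (vq * \<sigma> * (vq * pq)) / \<gamma>\<^sup>2)"
proof -
  define C where "C = 2 * \<kappa>^3 * b * G\<^sup>2 * \<eta>"
  define q where "q = vq * \<sigma> * (vq * pq)"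
  let ?I = "\<lambda>j. {nat (int t - 1 - int j)..<t}"
  have C: "0 \<le> C" "0 \<le> q" using assms kappa b vq_pq_nonneg sigma by (auto simp: C_def q_def)
  have eq: "memory_bd G \<kappa> b \<rho> \<eta> H w t = (\<Sum>j\<le>H. \<Sum>k<H. \<Sum>s\<in>?I j. C * \<rho> ^ j *
      (state_bd \<kappa> b \<rho> w (int t) * noise w (int t - 1 - int j - 1 - int k) *
        (state_bd \<kappa> b \<rho> w (int s) * sens w s k)))" for w :: "nat \<Rightarrow> real^'nx"
    unfolding memory_bd_def grad_bd_eq sum_distrib_left sum_distrib_right C_def
    by (intro sum.cong refl) (simp add: power2_eq_square power3_eq_cube mult_ac)
  have "mean_bdd (\<lambda>\<omega>. memory_bd G \<kappa> b \<rho> \<eta> H (Wp \<omega>) t) (\<Sum>j\<le>H. \<Sum>k<H. \<Sum>s\<in>?I j. C * \<rho> ^ j * q)"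
    unfolding eq q_def using C gamma
    by (intro mean_bdd_sum mean_bdd_cmult L4_bdd_prod4 L4_state L4_sens L4_noise) auto
  moreover have "(\<Sum>j\<le>H. \<Sum>k<H. \<Sum>s\<in>?I j. C * \<rho> ^ j * q) \<le> C * real H * q / \<gamma>\<^sup>2"
  proof -
    have "(\<Sum>j\<le>H. \<Sum>k<H. \<Sum>s\<in>?I j. C * \<rho> ^ j * q)
        \<le> (\<Sum>j\<le>H. C * real H * q * ((real j + 1) * \<rho> ^ j))"
    proof (rule sum_mono)
      fix j
      have "(\<Sum>k<H. \<Sum>s\<in>?I j. C * \<rho> ^ j * q) = real (card (?I j)) * (C * real H * q * \<rho> ^ j)"
        by (simp add: mult_ac)
      also have "\<dots> \<le> (real j + 1) * (C * real H * q * \<rho> ^ j)"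
        using C gamma by (intro mult_right_mono) auto
      finally show "(\<Sum>k<H. \<Sum>s\<in>?I j. C * \<rho> ^ j * q) \<le> C * real H * q * ((real j + 1) * \<rho> ^ j)"
        by (simp add: mult_ac)
    qed
    also have "\<dots> = C * real H * q * (\<Sum>j<Suc H. (real j + 1) * \<rho> ^ j)"
      by (simp only: sum_distrib_left lessThan_Suc_atMost)
    also have "\<dots> \<le> C * real H * q * (1 / \<gamma>\<^sup>2)"
      using C by (intro mult_left_mono sum_arith_geometric_le gamma) auto
    finally show ?thesis by simp
  qed
  ultimately show ?thesis unfolding C_def q_def by (rule mean_bdd_mono)
qed

lemma mean_trunc:
  "mean_bdd (\<lambda>\<omega>. trunc_bd G \<kappa> b \<rho> H (Wp \<omega>) t)
    (\<rho> ^ H * (G * (vq * (2 * \<kappa>^3 * vq + 4 * \<kappa>^8 * b * (3 * (\<sigma> / \<gamma>\<^sup>2))))))"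
proof -
  define U where "U w = 2 * \<kappa>^3 * state_bd \<kappa> b \<rho> w (int t - 1 - int H)
       + 4 * \<kappa>^8 * b * (filt \<rho> w (int t - 1 - int H) + filt2 \<rho> w (int t - int H) + filt \<rho> w (int t - int H))"
    for w :: "nat \<Rightarrow> real^'nx"
  have eq: "trunc_bd G \<kappa> b \<rho> H w t = \<rho> ^ H * (G * (state_bd \<kappa> b \<rho> w (int t) * U w))" for w
    by (simp add: trunc_bd_def U_def mult.assoc)
  have "L4_bdd (\<lambda>\<omega>. U (Wp \<omega>)) (2 * \<kappa>^3 * vq + 4 * \<kappa>^8 * b * (\<sigma> / \<gamma> + \<sigma> / \<gamma>\<^sup>2 + \<sigma> / \<gamma>))"
    unfolding U_def using kappa b
    by (intro L4_bdd_cmult L4_bdd_add L4_filt L4_filt2 L4_state) auto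
  moreover have "4 * \<kappa>^8 * b * (\<sigma> / \<gamma> + \<sigma> / \<gamma>\<^sup>2 + \<sigma> / \<gamma>) \<le> 4 * \<kappa>^8 * b * (3 * (\<sigma> / \<gamma>\<^sup>2))"
    using kappa b inv_gamma by (intro mult_left_mono) auto
  ultimately have U: "L4_bdd (\<lambda>\<omega>. U (Wp \<omega>)) (2 * \<kappa>^3 * vq + 4 * \<kappa>^8 * b * (3 * (\<sigma> / \<gamma>\<^sup>2)))"
    by (elim L4_bdd_mono) simp
  show ?thesis
    unfolding eq using gamma G by (intro mean_bdd_cmult L4_bdd_prod2 L4_state U) auto
qed

definition regret_bd :: "real \<Rightarrow> nat \<Rightarrow> nat \<Rightarrow> (nat \<Rightarrow> real^'nx) \<Rightarrow> real" where
  "regret_bd \<eta> H T w = (\<Sum>t<T. \<eta> / 2 * (\<Sum>i<H. (grad_bd G \<kappa> b \<rho> w t i)\<^sup>2)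
      + memory_bd G \<kappa> b \<rho> \<eta> H w t + trunc_bd G \<kappa> b \<rho> H w t)"

text \<open>The squared gradient and the drift each contribute 512, with the same powers of
  \<kappa>, \<open>b\<close> and \<sigma>; 224 = 8 * 28 is \<open>vq\<close> times the merged
  truncation factor.\<close>

lemma mean_regret_bd:
  assumes "0 \<le> \<eta>"
  shows "mean_bdd (\<lambda>\<omega>. regret_bd \<eta> H T (Wp \<omega>))
    (real T * (1024 * \<eta> * real H * G\<^sup>2 * \<kappa>^18 * b^6 * \<sigma>^4 / \<gamma>^7 + \<rho> ^ H * (224 * G * \<kappa>^15 * b^4 * \<sigma>\<^sup>2 / \<gamma>^4)))"
    (is "mean_bdd _ (real T * (?a + ?c))")
proof -
  define X where "X = G\<^sup>2 * \<kappa>^18 * b^6 * \<sigma>^4"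
  have X: "0 \<le> X" using kappa b by (simp add: X_def)
  note divs = divide_inverse power_inverse[symmetric]
  have 1: "G\<^sup>2 * (vq * pq * (vq * pq)) = 1024 * (X / \<gamma>^6)"
    unfolding vq_def pq_def X_def divs by algebra
  have 2: "2 * \<kappa>^3 * b * G\<^sup>2 * \<eta> * real H * (vq * \<sigma> * (vq * pq)) / \<gamma>\<^sup>2 = 512 * (\<eta> * real H) * (X / \<gamma>^7)"
    unfolding vq_def pq_def X_def divs by algebra
  have "X / \<gamma>^6 \<le> X / \<gamma>^7"
    using X gamma by (intro divide_left_mono power_decreasing) auto
  then have "512 * (\<eta> * real H) * (X / \<gamma>^6) \<le> 512 * (\<eta> * real H) * (X / \<gamma>^7)"
    using assms by (intro mult_left_mono) auto
  then have "\<eta> / 2 * (real H * (1024 * (X / \<gamma>^6))) + 512 * (\<eta> * real H) * (X / \<gamma>^7)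
      \<le> 512 * (\<eta> * real H) * (X / \<gamma>^7) + 512 * (\<eta> * real H) * (X / \<gamma>^7)"
    by (intro add_right_mono) (simp add: mult_ac)
  also have "\<dots> = 1024 * (\<eta> * real H) * (X / \<gamma>^7)" by simp
  also have "\<dots> = ?a" by (simp add: X_def)
  finally have a: "\<eta> / 2 * (real H * (G\<^sup>2 * (vq * pq * (vq * pq))))
      + 2 * \<kappa>^3 * b * G\<^sup>2 * \<eta> * real H * (vq * \<sigma> * (vq * pq)) / \<gamma>\<^sup>2 \<le> ?a"
    unfolding 1 2 .
  have c: "\<rho> ^ H * (G * (vq * (2 * \<kappa>^3 * vq + 4 * \<kappa>^8 * b * (3 * (\<sigma> / \<gamma>\<^sup>2))))) \<le> ?c"
  proof -
    define z where "z = \<sigma> / \<gamma>\<^sup>2"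
    have z: "0 \<le> z" using sigma by (simp add: z_def)
    have vz: "vq = 8 * \<kappa>^6 * b\<^sup>2 * z" by (simp add: vq_def z_def)
    have "\<kappa>^8 * b \<le> \<kappa>^9 * b\<^sup>2"
      using kappa b by (intro mult_mono power_increasing) (auto simp: power2_eq_square)
    then have "12 * (\<kappa>^8 * b) * z \<le> 12 * (\<kappa>^9 * b\<^sup>2) * z"
      using z by (intro mult_right_mono) auto
    moreover have "2 * \<kappa>^3 * vq + 4 * \<kappa>^8 * b * (3 * z) = 16 * (\<kappa>^9 * b\<^sup>2) * z + 12 * (\<kappa>^8 * b) * z"
      unfolding vz by algebra
    ultimately have "2 * \<kappa>^3 * vq + 4 * \<kappa>^8 * b * (3 * z) \<le> 28 * \<kappa>^9 * b\<^sup>2 * z"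
      by linarith
    then have "vq * (2 * \<kappa>^3 * vq + 4 * \<kappa>^8 * b * (3 * z)) \<le> vq * (28 * \<kappa>^9 * b\<^sup>2 * z)"
      by (rule mult_left_mono[OF _ vq_pq_nonneg(1)])
    also have "\<dots> = 224 * \<kappa>^15 * b^4 * z\<^sup>2" unfolding vz by algebra
    also have "z\<^sup>2 = \<sigma>\<^sup>2 / \<gamma>^4" by (simp add: z_def power_divide power_mult[symmetric])
    finally have "\<rho> ^ H * (G * (vq * (2 * \<kappa>^3 * vq + 4 * \<kappa>^8 * b * (3 * z))))
        \<le> \<rho> ^ H * (G * (224 * \<kappa>^15 * b^4 * (\<sigma>\<^sup>2 / \<gamma>^4)))"
      by (rule mult_left_mono[OF mult_left_mono]) (use gamma G in auto)
    also have "\<dots> = ?c" by simp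
    finally show ?thesis by (simp only: z_def)
  qed
  have "mean_bdd (\<lambda>\<omega>. regret_bd \<eta> H T (Wp \<omega>)) (\<Sum>t<T.
      \<eta> / 2 * (real H * (G\<^sup>2 * (vq * pq * (vq * pq))))
      + 2 * \<kappa>^3 * b * G\<^sup>2 * \<eta> * real H * (vq * \<sigma> * (vq * pq)) / \<gamma>\<^sup>2
      + \<rho> ^ H * (G * (vq * (2 * \<kappa>^3 * vq + 4 * \<kappa>^8 * b * (3 * (\<sigma> / \<gamma>\<^sup>2))))))"
    unfolding regret_bd_def by (intro mean_bdd_sum mean_bdd_add mean_grad mean_memory mean_trunc assms)
  then show ?thesis
    by (rule mean_bdd_mono)
       (simp only: sum_constant card_lessThan, rule mult_left_mono[OF add_mono[OF a c]], simp)
qed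

end

section \<open>Horizon, constants and conclusion\<close>

lemma horizon_bounds:
  fixes \<gamma> :: real
  assumes gamma: "0 < \<gamma>" "\<gamma> < 1" and T: "3 \<le> T"
  defines "H \<equiv> nat \<lceil>2 / \<gamma> * ln (real T)\<rceil>"
  shows "1 \<le> ln (real T)" "real H * \<gamma> \<le> 3 * ln (real T)" "real T * (1 - \<gamma>) ^ H \<le> 1"
proof -
  have "exp 1 \<le> real T" using exp_le T by linarith
  then show L: "1 \<le> ln (real T)" using T by (simp add: ln_ge_iff)
  have pos: "0 \<le> 2 / \<gamma> * ln (real T)" using gamma L by simp
  have le: "2 / \<gamma> * ln (real T) \<le> real H" unfolding H_def by (rule real_nat_ceiling_ge)
  have "real H \<le> 2 / \<gamma> * ln (real T) + 1"
    unfolding H_def using pos ceiling_correct[of "2 / \<gamma> * ln (real T)"] by (simp add: of_nat_nat)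
  then have "real H * \<gamma> \<le> (2 / \<gamma> * ln (real T) + 1) * \<gamma>"
    using gamma by (intro mult_right_mono) auto
  also have "\<dots> = 2 * ln (real T) + \<gamma>" using gamma by (simp add: field_simps)
  finally show "real H * \<gamma> \<le> 3 * ln (real T)" using gamma L by linarith
  \<comment> \<open>The exponent gives even T^-2; the T^-1 that is kept cancels the sum over
    \<open>T\<close> rounds.\<close>
  have "(1 - \<gamma>) ^ H \<le> exp (- \<gamma>) ^ H"
    using gamma exp_ge_add_one_self[of "- \<gamma>"] by (intro power_mono) auto
  also have "\<dots> = exp (- (real H * \<gamma>))" by (simp add: exp_of_nat_mult[symmetric])
  also have "\<dots> \<le> exp (- ln (real T))"
  proof -
    have "2 * ln (real T) \<le> real H * \<gamma>" using mult_right_mono[OF le, of \<gamma>] gamma by simp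
    then show ?thesis using L by simp
  qed
  also have "\<dots> = 1 / real T" using T by (simp add: exp_minus inverse_eq_divide)
  finally show "real T * (1 - \<gamma>) ^ H \<le> 1" using T by (simp add: field_simps)
qed

text \<open>\<open>C\<close> is \<delta> times the constant of the theorem. The number 6144 = 2 * 3
  * 1024 combines the half of \<open>C\<close> available, the 3 from the bound on \<open>H\<close>,
  and the mean. The maximum of \<sigma> and \<sigma>^4 serves the two inequalities in turn:
  \<sigma>^4 in the first, \<sigma>, later squared, in the second.\<close>

lemma regret_constant_bounds:
  fixes \<gamma> :: real
  assumes "0 < \<gamma>" "\<gamma> < 1" "1 \<le> \<kappa>" "1 \<le> b" "1 \<le> n" "1 \<le> G" "0 \<le> \<sigma>"
  defines "C \<equiv> 65724 * max \<sigma> (\<sigma> ^ 4) * n\<^sup>2 * G\<^sup>2 * b^6 * \<kappa>^18 / (\<gamma>^8 * (1 - \<gamma>) ^ 4)"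
  shows "6144 * G\<^sup>2 * \<kappa>^18 * b^6 * \<sigma>^4 / \<gamma>^8 \<le> C" "224 * \<kappa>^15 * b^4 * \<sigma>\<^sup>2 / \<gamma>^4 \<le> 6 * C\<^sup>2" "0 \<le> C"
proof -
  define s where "s = max \<sigma> (\<sigma> ^ 4)"
  have s: "0 \<le> s" "\<sigma> \<le> s" "\<sigma> ^ 4 \<le> s" using assms(7) by (auto simp: s_def)
  define Q where "Q = G\<^sup>2 * b^6 * \<kappa>^18 / \<gamma>^8"
  have Q: "0 \<le> Q" using assms by (simp add: Q_def)
  have "1 * 1 \<le> n\<^sup>2 * (1 / (1 - \<gamma>) ^ 4)"
  proof (rule mult_mono)
    have "(1 - \<gamma>) ^ 4 \<le> 1" using assms by (intro power_le_one) auto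
    then show "1 \<le> 1 / (1 - \<gamma>) ^ 4" using assms by (simp add: field_simps)
  qed (use assms in \<open>auto simp: one_le_power\<close>)
  then have "(65724 * s * Q) * 1 \<le> (65724 * s * Q) * (n\<^sup>2 * (1 / (1 - \<gamma>) ^ 4))"
    using s Q by (intro mult_left_mono) auto
  also have "\<dots> = C" by (simp add: C_def Q_def s_def)
  finally have C: "65724 * s * Q \<le> C" by simp
  show C0: "0 \<le> C" using C s Q by (meson mult_nonneg_nonneg order_trans zero_le_numeral)
  have "6144 * G\<^sup>2 * \<kappa>^18 * b^6 * \<sigma>^4 / \<gamma>^8 = 6144 * (\<sigma>^4 * Q)" by (simp add: Q_def)
  also have "\<dots> \<le> 65724 * (s * Q)"
    using s Q by (intro mult_mono) auto
  finally show "6144 * G\<^sup>2 * \<kappa>^18 * b^6 * \<sigma>^4 / \<gamma>^8 \<le> C" using C by simp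
  have "1 * b\<^sup>2 * \<kappa>^8 / \<gamma>\<^sup>2 \<le> Q"
    unfolding Q_def using assms
    by (intro frac_le mult_mono power_increasing power_decreasing) (auto simp: one_le_power)
  then have "\<sigma> * (b\<^sup>2 * \<kappa>^8 / \<gamma>\<^sup>2) \<le> s * Q"
    using s assms by (intro mult_mono) auto
  moreover have "0 \<le> s * Q" using s Q by simp
  ultimately have "15 * (\<sigma> * (b\<^sup>2 * \<kappa>^8 / \<gamma>\<^sup>2)) \<le> C" using C by simp
  then have sq: "(15 * (\<sigma> * (b\<^sup>2 * \<kappa>^8 / \<gamma>\<^sup>2)))\<^sup>2 \<le> C\<^sup>2"
    using assms(1-7) by (intro power_mono) auto
  \<comment> \<open>224 is rounded up to the square 225 = 15^2 and \<kappa>^15 to \<kappa>^16, to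
    allow comparison with a square.\<close>
  have "224 * \<kappa>^15 * b^4 * \<sigma>\<^sup>2 / \<gamma>^4 \<le> 225 * \<kappa>^16 * b^4 * \<sigma>\<^sup>2 / \<gamma>^4"
    using assms(1-7) by (intro divide_right_mono mult_right_mono mult_mono power_increasing) auto
  also have "\<dots> = (15 * (\<sigma> * (b\<^sup>2 * \<kappa>^8 / \<gamma>\<^sup>2)))\<^sup>2"
    by (simp add: power_mult_distrib power_divide power_mult[symmetric])
  also have "\<dots> \<le> 6 * C\<^sup>2" using sq zero_le_power2[of C] by linarith
  finally show "224 * \<kappa>^15 * b^4 * \<sigma>\<^sup>2 / \<gamma>^4 \<le> 6 * C\<^sup>2" .
qed

theorem theorem1:
  fixes \<Omega> :: "'w measure"
    and W :: "nat \<Rightarrow> 'w \<Rightarrow> real^'nx"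
    and A :: "real^'nx^'nx" and B :: "real^'nu^'nx" and K :: "real^'nx^'nu"
    and c :: "nat \<Rightarrow> real^'nx \<Rightarrow> real^'nu \<Rightarrow> real"
    and Gc \<sigma> \<kappa> \<gamma> \<delta> :: real and T :: nat and M0 :: "('nx,'nu) dap"
  assumes prob: "prob_space \<Omega>"
    and W_meas: "\<And>t. W t \<in> borel_measurable \<Omega>"
    and A1: "assumption_A1 c Gc"
    and sigma_nonneg: "\<sigma> \<ge> 0"
    and A2: "\<And>t. (\<integral>\<^sup>+ \<omega>. ennreal ((norm (W t \<omega>)) ^ 4) \<partial>\<Omega>) \<le> ennreal (\<sigma> ^ 4)"
    and kappa: "\<kappa> \<ge> 1" and gamma: "0 < \<gamma>" "\<gamma> < 1"
    and K_stable: "strongly_stable \<kappa> \<gamma> A B K"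
    and T: "T \<ge> 3"
    and delta: "0 < \<delta>" "\<delta> \<le> 1"
    and M0: "M0 \<in> Mset (nat \<lceil>2 / \<gamma> * ln (real T)\<rceil>) (max (spec_norm B) 1) \<kappa> \<gamma>"
    and min_attained: "\<forall>\<omega>\<in>space \<Omega>. \<exists>Kopt\<in>KK \<kappa> \<gamma> A B.
           \<forall>K'\<in>KK \<kappa> \<gamma> A B. lin_cost c A B Kopt (\<lambda>t. W t \<omega>) T \<le> lin_cost c A B K' (\<lambda>t. W t \<omega>) T"
  shows "let H = nat \<lceil>2 / \<gamma> * ln (real T)\<rceil>;
             \<eta> = (\<lambda>t::nat. 1 / (sqrt (real T) * (ln (real T)) ^ 3));
             n = real (max CARD('nx) CARD('nu));
             \<kappa>B = max (spec_norm B) 1;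
             D = 4 * \<kappa>B * \<kappa>^3 * sqrt n / \<gamma>;
             \<sigma>14 = max \<sigma> (\<sigma> ^ 4);
             C\<delta> = 65724 * \<sigma>14 * n^2 * Gc^2 * \<kappa>B^6 * \<kappa>^18 / (\<delta> * \<gamma>^8 * (1 - \<gamma>)^4);
             Regret = (\<lambda>\<omega>. dap_cost c H \<kappa> \<gamma> \<eta> A B K M0 (\<lambda>t. W t \<omega>) T
                         - (INF K'\<in>KK \<kappa> \<gamma> A B. lin_cost c A B K' (\<lambda>t. W t \<omega>) T))
         in \<exists>E\<in>sets \<Omega>. measure \<Omega> E \<ge> 1 - \<delta> \<and>
              (\<forall>\<omega>\<in>E. Regret \<omega> \<le>
                 (2 * sqrt 3 * Gc * C\<delta>^3 / sqrt \<gamma> + D^2 / 2) * sqrt (real T) * (ln (real T))^3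
                 + C\<delta> / 2 * sqrt (real T) * ln (real T)
                 + 6 * Gc * C\<delta>^2 * (ln (real T))^2)"
proof -
  interpret prob_space \<Omega> by (rule prob)
  define L where "L = ln (real T)"
  define H where "H = nat \<lceil>2 / \<gamma> * ln (real T)\<rceil>"
  define e where "e = 1 / (sqrt (real T) * (ln (real T)) ^ 3)"
  define n where "n = real (max CARD('nx) CARD('nu))"
  define \<kappa>B where "\<kappa>B = max (spec_norm B) 1"
  define D where "D = 4 * \<kappa>B * \<kappa>^3 * sqrt n / \<gamma>"
  define C where "C = 65724 * max \<sigma> (\<sigma> ^ 4) * n\<^sup>2 * Gc\<^sup>2 * \<kappa>B^6 * \<kappa>^18 / (\<gamma>^8 * (1 - \<gamma>) ^ 4)"
  define C\<delta> where "C\<delta> = 65724 * max \<sigma> (\<sigma> ^ 4) * n^2 * Gc^2 * \<kappa>B^6 * \<kappa>^18 / (\<delta> * \<gamma>^8 * (1 - \<gamma>)^4)"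
  \<comment> \<open>The budget for the random part alone; the summand with \<open>D\<close> pays for
    the deterministic initial distance.\<close>
  define R where "R = C\<delta> / 2 * sqrt (real T) * L + 6 * Gc * C\<delta>\<^sup>2 * L\<^sup>2"
  have Gc: "1 \<le> Gc" using A1 by (simp add: assumption_A1_def)
  have b: "1 \<le> \<kappa>B" by (simp add: \<kappa>B_def)
  have "1 \<le> CARD('nx)" using zero_less_card_finite[where 'a='nx] by linarith
  then have n: "1 \<le> n" "real CARD('nx) \<le> n" by (auto simp: n_def le_max_iff_disj)
  note hor = horizon_bounds[OF gamma T, folded H_def L_def]
  note con = regret_constant_bounds[OF gamma kappa b n(1) Gc sigma_nonneg, folded C_def]
  have C\<delta>: "C\<delta> = C / \<delta>" by (simp add: C_def C\<delta>_def mult_ac)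
  have sT: "0 < sqrt (real T)" "sqrt (real T) * sqrt (real T) = real T" using T by auto
  have L: "0 < L" using hor(1) by linarith
  have e: "0 < e" using sT L by (simp add: e_def L_def)
  have inv_e: "1 / e = sqrt (real T) * L ^ 3" by (simp add: e_def L_def)

  interpret np: noise_process \<Omega> W \<sigma> \<kappa> \<gamma> \<kappa>B Gc
    by unfold_locales (use W_meas sigma_nonneg A2 kappa gamma b Gc in auto)
  let ?W = "\<lambda>\<omega> t. W t \<omega>"
  let ?E = "{\<omega>\<in>space \<Omega>. np.regret_bd e H T (?W \<omega>) \<le> R}"
  let ?r = "real T * (1024 * e * real H * Gc\<^sup>2 * \<kappa>^18 * \<kappa>B^6 * \<sigma>^4 / \<gamma>^7
     + (1 - \<gamma>) ^ H * (224 * Gc * \<kappa>^15 * \<kappa>B^4 * \<sigma>\<^sup>2 / \<gamma>^4))"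
  have mean: "mean_bdd (\<lambda>\<omega>. np.regret_bd e H T (?W \<omega>)) ?r"
    using np.mean_regret_bd e by simp
  have "?r \<le> \<delta> * R"
  proof -
    define X where "X = Gc\<^sup>2 * \<kappa>^18 * \<kappa>B^6 * \<sigma>^4 / \<gamma>^8"
    have X: "0 \<le> X" "6144 * X \<le> C" using con(1) b kappa gamma by (auto simp: X_def)
    \<comment> \<open>The learning rate leaves L^-3, against a single L from \<open>H\<close>, so
      the mean is of order sqrt T / L^2.\<close>
    have Te: "real T * e = sqrt (real T) / L ^ 3"
      using sT L by (simp add: e_def L_def[symmetric] divide_simps)
    have "real T * (1024 * e * real H * Gc\<^sup>2 * \<kappa>^18 * \<kappa>B^6 * \<sigma>^4 / \<gamma>^7)
        = 1024 * X * (real T * e) * (real H * \<gamma>)"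
      using gamma by (simp add: X_def eval_nat_numeral)
    also have "\<dots> \<le> 1024 * X * (real T * e) * (3 * L)"
      using X e hor(2) by (intro mult_left_mono) auto
    also have "\<dots> = 3072 * X * sqrt (real T) * (1 / L\<^sup>2)"
      unfolding Te using L by (simp add: eval_nat_numeral)
    also have "\<dots> \<le> 3072 * X * sqrt (real T) * L"
    proof (rule mult_left_mono)
      have "1 / L\<^sup>2 \<le> 1" using hor(1) by (simp add: one_le_power)
      then show "1 / L\<^sup>2 \<le> L" using hor(1) by linarith
    qed (use X in auto)
    also have "\<dots> \<le> (C / 2) * sqrt (real T) * L"
      using X L by (intro mult_right_mono) auto
    also have "\<dots> = \<delta> * (C\<delta> / 2 * sqrt (real T) * L)" using delta by (simp add: C\<delta>)
    finally have 1: "real T * (1024 * e * real H * Gc\<^sup>2 * \<kappa>^18 * \<kappa>B^6 * \<sigma>^4 / \<gamma>^7)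
        \<le> \<delta> * (C\<delta> / 2 * sqrt (real T) * L)" .
    have "real T * ((1 - \<gamma>) ^ H * (224 * Gc * \<kappa>^15 * \<kappa>B^4 * \<sigma>\<^sup>2 / \<gamma>^4))
        = (real T * (1 - \<gamma>) ^ H) * (Gc * (224 * \<kappa>^15 * \<kappa>B^4 * \<sigma>\<^sup>2 / \<gamma>^4))" by simp
    also have "\<dots> \<le> 1 * (Gc * (6 * C\<^sup>2))"
      using hor(3) con(2) Gc kappa b gamma by (intro mult_mono) auto
    \<comment> \<open>Since \<open>C\<delta>\<close> is squared, the target still carries 1/\<delta>
      after multiplication by \<delta>.\<close>
    also have "\<dots> \<le> (1 / \<delta> * L\<^sup>2) * (Gc * (6 * C\<^sup>2))"
    proof (rule mult_right_mono)
      have "1 * 1 \<le> 1 / \<delta> * L\<^sup>2"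
        using delta hor(1) by (intro mult_mono) (auto simp: one_le_power)
      then show "1 \<le> 1 / \<delta> * L\<^sup>2" by simp
    qed (use Gc in auto)
    also have "\<dots> = \<delta> * (6 * Gc * C\<delta>\<^sup>2 * L\<^sup>2)"
      using delta by (simp add: C\<delta> power2_eq_square)
    finally show ?thesis using 1 by (simp only: R_def distrib_left)
  qed
  from mean_bdd_Markov[OF mean this delta] have pE: "measure \<Omega> ?E \<ge> 1 - \<delta>" .
  have "(\<lambda>\<omega>. np.regret_bd e H T (?W \<omega>)) \<in> borel_measurable \<Omega>"
    using mean by (simp add: mean_bdd_def)
  then have sE: "?E \<in> sets \<Omega>" by measurable

  have reg: "dap_cost c H \<kappa> \<gamma> (\<lambda>_. e) A B K M0 (?W \<omega>) T - (INF K'\<in>KK \<kappa> \<gamma> A B. lin_cost c A B K' (?W \<omega>) T)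
      \<le> (2 * sqrt 3 * Gc * C\<delta>^3 / sqrt \<gamma> + D^2 / 2) * sqrt (real T) * L^3
         + C\<delta> / 2 * sqrt (real T) * L + 6 * Gc * C\<delta>^2 * L^2" if \<omega>: "\<omega> \<in> ?E" for \<omega>
  proof -
    interpret ds: dap_system A B K c Gc \<kappa> \<gamma> e H M0 "?W \<omega>"
      by unfold_locales (use A1 kappa gamma K_stable e M0 in \<open>auto simp: H_def\<close>)
    obtain K' where K': "K' \<in> KK \<kappa> \<gamma> A B"
      and min: "\<And>K''. K'' \<in> KK \<kappa> \<gamma> A B \<Longrightarrow> lin_cost c A B K' (?W \<omega>) T \<le> lin_cost c A B K'' (?W \<omega>) T"
      using min_attained \<omega> by blast
    \<comment> \<open>The attained minimum is a lower bound of a nonempty set, so the conditional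
      infimum behaves as a minimum here.\<close>
    have "lin_cost c A B K' (?W \<omega>) T \<le> (INF K'\<in>KK \<kappa> \<gamma> A B. lin_cost c A B K' (?W \<omega>) T)"
      using K' min by (intro cINF_greatest) auto
    moreover have "dap_cost c H \<kappa> \<gamma> (\<lambda>_. e) A B K M0 (?W \<omega>) T - lin_cost c A B K' (?W \<omega>) T
        \<le> 16 * real CARD('nx) * \<kappa>B\<^sup>2 * \<kappa>^6 / \<gamma>\<^sup>2 / (2 * e) + np.regret_bd e H T (?W \<omega>)"
      using ds.pathwise_regret[OF K'[unfolded KK_def mem_Collect_eq], of T]
      by (simp only: np.regret_bd_def \<kappa>B_def[symmetric])
    moreover have "16 * real CARD('nx) * \<kappa>B\<^sup>2 * \<kappa>^6 / \<gamma>\<^sup>2 / (2 * e) \<le> D\<^sup>2 / 2 * sqrt (real T) * L ^ 3"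
    proof -
      have "16 * real CARD('nx) * \<kappa>B\<^sup>2 * \<kappa>^6 / \<gamma>\<^sup>2 \<le> 16 * n * \<kappa>B\<^sup>2 * \<kappa>^6 / \<gamma>\<^sup>2"
        using n kappa by (intro divide_right_mono mult_right_mono) auto
      also have "\<dots> = D\<^sup>2"
        using n by (simp add: D_def power_mult_distrib power_divide power_mult[symmetric])
      finally have "16 * real CARD('nx) * \<kappa>B\<^sup>2 * \<kappa>^6 / \<gamma>\<^sup>2 / (2 * e) \<le> D\<^sup>2 / (2 * e)"
        using e by (intro divide_right_mono) auto
      also have "\<dots> = D\<^sup>2 / 2 * (1 / e)" by simp
      finally show ?thesis by (simp only: inv_e mult.assoc)
    qed
    moreover have "np.regret_bd e H T (?W \<omega>) \<le> R" using \<omega> by simp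
    \<comment> \<open>The remaining summand of the target enters through its sign; \<open>R\<close>
      and the \<open>D\<close> term already cover the regret.\<close>
    moreover have "0 \<le> 2 * sqrt 3 * Gc * C\<delta>^3 / sqrt \<gamma> * sqrt (real T) * L^3"
      using Gc con(3) delta gamma L by (simp add: C\<delta>)
    ultimately show ?thesis unfolding R_def distrib_right by linarith
  qed
  have "\<exists>E\<in>sets \<Omega>. measure \<Omega> E \<ge> 1 - \<delta> \<and> (\<forall>\<omega>\<in>E.
      dap_cost c H \<kappa> \<gamma> (\<lambda>_. e) A B K M0 (?W \<omega>) T - (INF K'\<in>KK \<kappa> \<gamma> A B. lin_cost c A B K' (?W \<omega>) T)
      \<le> (2 * sqrt 3 * Gc * C\<delta>^3 / sqrt \<gamma> + D^2 / 2) * sqrt (real T) * L^3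
         + C\<delta> / 2 * sqrt (real T) * L + 6 * Gc * C\<delta>^2 * L^2)"
    using sE pE reg by blast
  then show ?thesis
    unfolding Let_def D_def C\<delta>_def e_def H_def L_def n_def \<kappa>B_def .
qed

end
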